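(* Let $r\ge1$ be an integer. A function $q\in L_r^2(T^{\rm ps})$ is uniquely determined by the following degrees of freedom: (a) $q(z_i)$, $1\le i\le3$ ($3$ DOFs); (b) $q(z_{3+i})$, $1\le i\le3$ ($3$ DOFs); (c) $\int_eq\,p$ for all $p\in\mathcal P_{r-2}(e)$, $e\in\mathcal E^b(T^{\rm ps})$ ($6(r-1)$ DOFs); (d) $\int_Tq$ ($1$ DOF); (e) $\int_Tq\,p$ for all $p\in\mathring L_r^2(T^{\rm ps})$ ($3r(r-1)$ DOFs).
   Context: Let $T\subset\mathbb R^2$ be a (closed, nondegenerate) triangle with vertices $z_1,z_2,z_3$, labelled counter-clockwise, and let $z_0$ be a point in the interior of $T$. Let $e_i=[z_{i+1},z_{i+2}]$ (indices $1,2,3$ modulo $3$) be the edge opposite $z_i$, and let $z_{3+i}$ be a point in the relative interior of $e_i$, $i=1,2,3$. The Powell--Sabin split $T^{\rm ps}=\{T_1,\dots,T_6\}$ is the triangulation of $T$ obtained by connecting $z_0$ to each of $z_1,\dots,z_6$. $\mathcal E^b(T^{\rm ps})$ is the set of the six boundary edges of $T^{\rm ps}$ (each $e_i$ is divided in two by $z_{3+i}$). $\mathcal P_k(S)$ is the space of polynomials of degree $\le k$ on $S$, with $\mathcal P_k(S)=\{0\}$ for $k<0$; $L_r^2(T^{\rm ps})=\{q\in C(T): q|_S\in\mathcal P_r(S)\ \forall S\in T^{\rm ps}\}$; $\mathring L_r^2(T^{\rm ps})=\{q\in L_r^2(T^{\rm ps}): q=0\text{ on }\partial T,\ \int_Tq=0\}$.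 "Uniquely determined by the degrees of freedom" means that the degrees of freedom are unisolvent: their number equals the dimension of the space (here $\dim L_r^2(T^{\rm ps})=3r^2+3r+1$), and the only function in the space at which all of them vanish is $0$. *)

theory Defs
  imports "HOL-Analysis.Analysis" "HOL-Library.Function_Algebras"
begin

(* Pointwise vector space structure on real-valued functions; fun_space.dim is its dimension. *)
interpretation fun_space: vector_space "\<lambda>(c::real) (f::'a \<Rightarrow> real) x. c * f x"
  by unfold_locales (auto simp: fun_eq_iff algebra_simps)

(* A real function on a set S is represented by its extension by 0 outside S, so that
   functions on S form a subspace of the functions on the plane and are equal
   iff they agree on S. *)
definition restrict0 :: "'a set \<Rightarrow> ('a \<Rightarrow> real) \<Rightarrow> 'a \<Rightarrow> real" where
  "restrict0 S f = (\<lambda>x. if x \<in> S then f x else 0)"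

(* Polynomials on S of total degree at most k. The integer degree bound makes the index set
   of monomials empty, and hence the space {0}, for k < 0. *)
definition polys_on :: "int \<Rightarrow> (real^2) set \<Rightarrow> (real^2 \<Rightarrow> real) set" where
  "polys_on k S = range (\<lambda>c :: nat \<Rightarrow> nat \<Rightarrow> real.
     restrict0 S (\<lambda>x. \<Sum>(i, j) \<in> {(i, j). int i + int j \<le> k}. c i j * (x $ 1) ^ i * (x $ 2) ^ j))"

(* Cyclic successor on the indices 1, 2, 3. *)
definition nxt :: "nat \<Rightarrow> nat" where
  "nxt i = i mod 3 + 1"

definition ps_triangle :: "(nat \<Rightarrow> real^2) \<Rightarrow> (real^2) set" where
  "ps_triangle z = convex hull {z 1, z 2, z 3}"

(* z 1, z 2, z 3 are the vertices of the triangle, counter-clockwise (the sign condition also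
   gives nondegeneracy); z 0 is the interior split point; z (3 + i) lies in the relative
   interior of the edge opposite z i. Values z n for n > 6 are irrelevant. *)
definition ps_points :: "(nat \<Rightarrow> real^2) \<Rightarrow> bool" where
  "ps_points z \<longleftrightarrow>
     (z 2 - z 1) $ 1 * (z 3 - z 1) $ 2 - (z 2 - z 1) $ 2 * (z 3 - z 1) $ 1 > 0 \<and>
     z 0 \<in> interior (ps_triangle z) \<and>
     (\<forall>i \<in> {1..3}. z (3 + i) \<in> open_segment (z (nxt i)) (z (nxt (nxt i))))"

(* The six boundary edges, each given by its pair of endpoints (counter-clockwise). *)
definition ps_bdry_edges :: "(nat \<Rightarrow> real^2) \<Rightarrow> ((real^2) \<times> (real^2)) set" where
  "ps_bdry_edges z =
     (\<Union>i \<in> {1..3}. {(z (nxt i), z (3 + i)), (z (3 + i), z (nxt (nxt i)))})"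

definition ps_split :: "(nat \<Rightarrow> real^2) \<Rightarrow> (real^2) set set" where
  "ps_split z = (\<lambda>(a, b). convex hull {z 0, a, b}) ` ps_bdry_edges z"

definition lagrange :: "nat \<Rightarrow> (nat \<Rightarrow> real^2) \<Rightarrow> (real^2 \<Rightarrow> real) set" where
  "lagrange r z = {q. continuous_on (ps_triangle z) q \<and>
     (\<forall>x. x \<notin> ps_triangle z \<longrightarrow> q x = 0) \<and>
     (\<forall>S \<in> ps_split z. restrict0 S q \<in> polys_on (int r) S)}"

definition lagrange0 :: "nat \<Rightarrow> (nat \<Rightarrow> real^2) \<Rightarrow> (real^2 \<Rightarrow> real) set" where
  "lagrange0 r z = {q \<in> lagrange r z.
     (\<forall>x \<in> frontier (ps_triangle z). q x = 0) \<and> integral (ps_triangle z) q = 0}"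

(* Arc-length integral over the segment from a to b (independent of its orientation). *)
definition edge_integral :: "real^2 \<Rightarrow> real^2 \<Rightarrow> (real^2 \<Rightarrow> real) \<Rightarrow> real" where
  "edge_integral a b f = dist a b * integral {0..1} (\<lambda>t. f (linepath a b t))"

end

(* On the triangle with vertices z 0, v, w of the split write a point as m z 0 + s v + t w with
   m + s + t = 1. The coefficients of the six boundary points extend to continuous
   piecewise affine functions lam k on T, and the products
   lam0^(r-i-j) (lam k)^i (lam (next k))^j with lam0 = 1 - sum of all lam k restrict to Bernstein
   monomials on each triangle; matching coefficients along the six interior edges shows
   that those with i >= 1, together with lam0^r, form a basis. Since lam0 vanishes exactly on the
   boundary, the functions vanishing there are spanned by the basis elements with i + j < r,
   and correcting each by a multiple of lam0^r, whose integral is positive, handles the zero mean.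
   For unisolvence, on a boundary edge q = t (1 - t) g with deg g <= r - 2, and testing with g
   gives q = 0 on the boundary; then q is itself an admissible test function in (e). *)
theory Submission
  imports Defs
begin

section \<open>Dimension of a space of functions with a parametrization\<close>

text \<open>The vanishing argument uses no basis; the basis is there for the two dimension counts,
  which turn "all degrees of freedom vanish only at 0" into unisolvence. Polynomials are given in
  Cartesian coordinates, whereas matching across interior edges concerns barycentric coefficients.
  Homogeneous forms in three variables serve both: Cartesian coordinates have first variable 1,
  barycentric ones have variables with sum 1, and passing between them is a linear substitution that
  keeps the degree. The Bernstein monomials carry no binomial factors, so dividing by t (1 - t) on
  an edge merely shifts coefficients. The spaces are studied on an abstract fan of triangles that
  comes with functions \<open>lam k\<close>; for the Powell-Sabin split these functions are built
  from minima of scaled barycentric coordinates, so that their continuity needs no gluing.\<close>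

lemma sum_fun_apply: "(\<Sum>i\<in>I. f i) x = (\<Sum>i\<in>I. f i x)"
  for f :: "'i \<Rightarrow> 'a \<Rightarrow> 'b::comm_monoid_add"
  by (induction I rule: infinite_finite_induct) auto

lemma fun_space_dim_eq_card:
  fixes f :: "'i \<Rightarrow> 'a \<Rightarrow> real"
  assumes fin: "finite I"
    and mem: "\<And>i. i \<in> I \<Longrightarrow> f i \<in> V"
    and ind: "\<And>a i. (\<And>x. (\<Sum>i\<in>I. a i * f i x) = 0) \<Longrightarrow> i \<in> I \<Longrightarrow> a i = 0"
    and spn: "\<And>q. q \<in> V \<Longrightarrow> \<exists>a. \<forall>x. q x = (\<Sum>i\<in>I. a i * f i x)"
  shows "fun_space.dim V = card I"
proof (rule fun_space.dim_unique)
  have inj: "inj_on f I"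
  proof (rule inj_onI, rule ccontr)
    fix i j assume ij: "i \<in> I" "j \<in> I" "f i = f j" "i \<noteq> j"
    define a where "a k = (if k = i then 1 else if k = j then -1 else (0::real))" for k
    have "(\<Sum>k\<in>I. a k * f k x) = 0" for x
    proof -
      have "(\<Sum>k\<in>I. a k * f k x) = (\<Sum>k\<in>{i,j}. a k * f k x)"
        using fin ij by (intro sum.mono_neutral_right) (auto simp: a_def)
      also have "\<dots> = 0" using ij by (simp add: a_def)
      finally show ?thesis .
    qed
    from ind[OF this ij(1)] show False by (simp add: a_def)
  qed
  show "f ` I \<subseteq> V" using mem by auto
  show "card (f ` I) = card I" using inj by (rule card_image)
  show "V \<subseteq> fun_space.span (f ` I)"
  proof
    fix q assume "q \<in> V"
    then obtain a where "\<forall>x. q x = (\<Sum>i\<in>I. a i * f i x)" using spn by blast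
    then have "q = (\<Sum>i\<in>I. (\<lambda>x. a i * f i x))"
      by (auto simp: fun_eq_iff sum_fun_apply)
    also have "\<dots> \<in> fun_space.span (f ` I)"
      by (intro fun_space.span_sum fun_space.span_scale fun_space.span_base) auto
    finally show "q \<in> fun_space.span (f ` I)" .
  qed
  show "fun_space.independent (f ` I)"
    unfolding fun_space.dependent_finite[OF finite_imageI[OF fin]]
  proof clarify
    fix u v assume eq: "(\<Sum>v\<in>f ` I. (\<lambda>x. u v * v x)) = 0" and v: "v \<in> I" and nz: "u (f v) \<noteq> 0"
    have "(\<Sum>i\<in>I. u (f i) * f i x) = 0" for x
    proof -
      have "(\<Sum>i\<in>I. u (f i) * f i x) = (\<Sum>g\<in>f ` I. u g * g x)"
        using inj by (simp add: sum.reindex)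
      also have "\<dots> = (\<Sum>v\<in>f ` I. (\<lambda>x. u v * v x)) x" by (simp add: sum_fun_apply)
      finally show ?thesis by (simp add: eq)
    qed
    from ind[of "\<lambda>i. u (f i)", OF this v] nz show False by simp
  qed
qed

section \<open>Homogeneous polynomials in three variables\<close>

abbreviation exps :: "nat \<Rightarrow> (nat \<times> nat) set" where
  "exps k \<equiv> {(i, j). i + j \<le> k}"

lemma finite_exps [simp]: "finite (exps k)"
  by (rule finite_subset[of _ "{..k} \<times> {..k}"]) auto

text \<open>Homogeneous polynomials of degree \<open>k\<close>, as functions. The inductive
  generation gives closure under products and linear substitution without handling coefficients;
  \<open>form_iff\<close> recovers the coefficients when they are needed.\<close>

inductive form :: "nat \<Rightarrow> (real \<Rightarrow> real \<Rightarrow> real \<Rightarrow> real) \<Rightarrow> bool" where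
  form_zero: "form k (\<lambda>m s t. 0)"
| form_add: "form k f \<Longrightarrow> form k g \<Longrightarrow> form k (\<lambda>m s t. f m s t + g m s t)"
| form_monom: "form (a + b + c) (\<lambda>m s t. d * m ^ a * s ^ b * t ^ c)"

lemma form_linear: "form 1 (\<lambda>m s t. d * m + e * s + f * t)"
proof -
  have "form 1 (\<lambda>m s t. d * m)" "form 1 (\<lambda>m s t. e * s)" "form 1 (\<lambda>m s t. f * t)"
    using form_monom[of 1 0 0 d] form_monom[of 0 1 0 e] form_monom[of 0 0 1 f] by simp_all
  then show ?thesis by (intro form_add)
qed

lemma form_const: "form 0 (\<lambda>m s t. d)"
  using form_monom[of 0 0 0 d] by simp

lemma form_mult_monom:
  "form k f \<Longrightarrow> form (k + (a + b + c)) (\<lambda>m s t. f m s t * (d * m ^ a * s ^ b * t ^ c))"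
proof (induction rule: form.induct)
  case (form_add k f g)
  then show ?case unfolding distrib_right by (intro form.form_add)
next
  case (form_monom a' b' c' d')
  have arity: "a' + b' + c' + (a + b + c) = (a' + a) + (b' + b) + (c' + c)" by simp
  have "d' * m ^ a' * s ^ b' * t ^ c' * (d * m ^ a * s ^ b * t ^ c)
      = (d' * d) * m ^ (a' + a) * s ^ (b' + b) * t ^ (c' + c)" for m s t :: real
    by (simp add: power_add)
  then show ?case unfolding arity by (simp only: form.form_monom)
qed (simp add: form_zero)

lemma form_mult:
  assumes "form l g" "form k f"
  shows "form (k + l) (\<lambda>m s t. f m s t * g m s t)"
  using assms
proof (induction rule: form.induct)
  case (form_add k f g)
  then show ?case unfolding distrib_left by (intro form.form_add)
next
  case (form_monom a b c d)
  then show ?case by (rule form_mult_monom)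
qed (simp add: form_zero)

lemma form_power: "form k f \<Longrightarrow> form (n * k) (\<lambda>m s t. f m s t ^ n)"
proof (induction n)
  case (Suc n)
  then show ?case using form_mult[of "n * k" "\<lambda>m s t. f m s t ^ n" k f] by simp
qed (simp add: form_const)

lemma form_cmult: "form k f \<Longrightarrow> form k (\<lambda>m s t. d * f m s t)"
  using form_mult[of k f 0, OF _ form_const] by simp

lemma form_sum: "(\<And>i. i \<in> A \<Longrightarrow> form k (f i)) \<Longrightarrow> form k (\<lambda>m s t. \<Sum>i\<in>A. f i m s t)"
proof (induction A rule: infinite_finite_induct)
  case (insert x F)
  then show ?case by (simp add: form_add)
qed (simp_all add: form_zero)

lemma form_subst:
  assumes "form k g" "form 1 f\<^sub>1" "form 1 f\<^sub>2" "form 1 f\<^sub>3"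
  shows "form k (\<lambda>m s t. g (f\<^sub>1 m s t) (f\<^sub>2 m s t) (f\<^sub>3 m s t))"
  using assms(1)
proof (induction rule: form.induct)
  case (form_monom a b c d)
  have "form (a + b) (\<lambda>m s t. f\<^sub>1 m s t ^ a * f\<^sub>2 m s t ^ b)"
    using form_mult[OF form_power[OF assms(3), of b] form_power[OF assms(2), of a]] by simp
  from form_mult[OF form_power[OF assms(4), of c] this]
  have "form (a + b + c) (\<lambda>m s t. f\<^sub>1 m s t ^ a * f\<^sub>2 m s t ^ b * f\<^sub>3 m s t ^ c)" by simp
  from form_cmult[OF this, of d] show ?case by (simp add: mult.assoc)
next
  case (form_add k f g)
  then show ?case by (intro form.form_add)
qed (rule form_zero)

lemma form_iff:
  "form k g \<longleftrightarrow>
   (\<exists>c. g = (\<lambda>m s t. \<Sum>(i, j)\<in>exps k. c i j * m ^ (k - i - j) * s ^ i * t ^ j))"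
proof
  assume "form k g"
  then show "\<exists>c. g = (\<lambda>m s t. \<Sum>(i, j)\<in>exps k. c i j * m ^ (k - i - j) * s ^ i * t ^ j)"
  proof (induction rule: form.induct)
    case (form_zero k)
    show ?case by (rule exI[of _ "\<lambda>i j. 0"]) simp
  next
    case (form_add k f g)
    then obtain c d where
      "f = (\<lambda>m s t. \<Sum>(i, j)\<in>exps k. c i j * m ^ (k - i - j) * s ^ i * t ^ j)"
      "g = (\<lambda>m s t. \<Sum>(i, j)\<in>exps k. d i j * m ^ (k - i - j) * s ^ i * t ^ j)"
      by blast
    then show ?case
      by (intro exI[of _ "\<lambda>i j. c i j + d i j"])
        (simp add: fun_eq_iff sum.distrib[symmetric] split_def distrib_right)
  next
    case (form_monom a b c d)
    have "(\<Sum>(i, j)\<in>exps (a + b + c). (if i = b \<and> j = c then d else 0)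
        * m ^ (a + b + c - i - j) * s ^ i * t ^ j) = d * m ^ a * s ^ b * t ^ c"
      (is "?S = _") for m s t :: real
    proof -
      have "?S = (\<Sum>(i, j)\<in>{(b, c)}. (if i = b \<and> j = c then d else 0)
        * m ^ (a + b + c - i - j) * s ^ i * t ^ j)"
        by (rule sum.mono_neutral_right) (auto split: if_splits)
      then show ?thesis by simp
    qed
    then show ?case
      by (intro exI[of _ "\<lambda>i j. if i = b \<and> j = c then d else 0"]) simp
  qed
next
  assume "\<exists>c. g = (\<lambda>m s t. \<Sum>(i, j)\<in>exps k. c i j * m ^ (k - i - j) * s ^ i * t ^ j)"
  then obtain c where
    g: "g = (\<lambda>m s t. \<Sum>(i, j)\<in>exps k. c i j * m ^ (k - i - j) * s ^ i * t ^ j)" by blast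
  have "form k (\<lambda>m s t. c i j * m ^ (k - i - j) * s ^ i * t ^ j)" if "i + j \<le> k" for i j
    using form_monom[of "k - i - j" i j "c i j"] that by simp
  then show "form k g" unfolding g split_def by (intro form_sum) auto
qed

text \<open>Putting the first variable equal to 1 dehomogenizes: its exponent
  \<open>k - i - j\<close> fills the degree up to exactly \<open>k\<close>.\<close>

lemma polys_on_eq_forms:
  "polys_on (int k) S = {restrict0 S (\<lambda>x. g 1 (x $ 1) (x $ 2)) | g. form k g}"
proof -
  have eq: "restrict0 S (\<lambda>x. \<Sum>(i, j)\<in>{(i, j). int i + int j \<le> int k}. c i j * (x $ 1) ^ i * (x $ 2) ^ j)
      = restrict0 S (\<lambda>x. (\<lambda>m s t. \<Sum>(i, j)\<in>exps k. c i j * m ^ (k - i - j) * s ^ i * t ^ j) 1 (x $ 1) (x $ 2))"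
    for c :: "nat \<Rightarrow> nat \<Rightarrow> real"
  proof -
    have "{(i, j). int i + int j \<le> int k} = exps k" by auto
    then show ?thesis by simp
  qed
  show ?thesis unfolding polys_on_def form_iff eq
  proof (intro equalityI subsetI, goal_cases)
    case (1 f)
    then show ?case by (elim rangeE) (intro CollectI exI conjI, assumption, rule refl)
  next
    case (2 f)
    then show ?case by (elim CollectE exE conjE) (simp only:, rule rangeI)
  qed
qed

lemma polys_on_neg: "k < 0 \<Longrightarrow> polys_on k S = {\<lambda>x. 0}"
  by (auto simp: polys_on_def restrict0_def)

text \<open>This and the next two lemmas restrict a form to the three sides of the reference
  triangle. Since \<open>0 ^ 0 = 1\<close>, the coefficients that remain are those in which the
  vanishing variable has exponent 0.\<close>

lemma sum_exps_s0:
  "(\<Sum>(i, j)\<in>exps k. c i j * m ^ (k - i - j) * 0 ^ i * t ^ j)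
     = (\<Sum>j\<le>k. c 0 j * m ^ (k - j) * t ^ j)"
  for m t :: real
proof -
  have "(\<Sum>(i, j)\<in>exps k. c i j * m ^ (k - i - j) * 0 ^ i * t ^ j)
     = (\<Sum>(i, j)\<in>Pair 0 ` {..k}. c i j * m ^ (k - i - j) * 0 ^ i * t ^ j)"
    by (rule sum.mono_neutral_right) auto
  then show ?thesis by (simp add: sum.reindex inj_on_def)
qed

lemma sum_exps_t0:
  "(\<Sum>(i, j)\<in>exps k. c i j * m ^ (k - i - j) * s ^ i * 0 ^ j)
     = (\<Sum>i\<le>k. c i 0 * m ^ (k - i) * s ^ i)"
  for m s :: real
proof -
  have "(\<Sum>(i, j)\<in>exps k. c i j * m ^ (k - i - j) * s ^ i * 0 ^ j)
     = (\<Sum>(i, j)\<in>(\<lambda>i. (i, 0)) ` {..k}. c i j * m ^ (k - i - j) * s ^ i * 0 ^ j)"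
    by (rule sum.mono_neutral_right) auto
  then show ?thesis by (simp add: sum.reindex inj_on_def)
qed

lemma sum_exps_m0:
  "(\<Sum>(i, j)\<in>exps k. c i j * 0 ^ (k - i - j) * s ^ i * t ^ j)
     = (\<Sum>j\<le>k. c (k - j) j * s ^ (k - j) * t ^ j)"
  for s t :: real
proof -
  have "(\<Sum>(i, j)\<in>exps k. c i j * 0 ^ (k - i - j) * s ^ i * t ^ j)
     = (\<Sum>(i, j)\<in>(\<lambda>j. (k - j, j)) ` {..k}. c i j * 0 ^ (k - i - j) * s ^ i * t ^ j)"
  proof (rule sum.mono_neutral_right)
    show "\<forall>p\<in>exps k - (\<lambda>j. (k - j, j)) ` {..k}. (case p of (i, j) \<Rightarrow> c i j * 0 ^ (k - i - j) * s ^ i * t ^ j) = 0"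
    proof clarify
      fix i j assume ij: "i + j \<le> k" "(i, j) \<notin> (\<lambda>j. (k - j, j)) ` {..k}"
      have "k - i - j \<noteq> 0"
      proof
        assume "k - i - j = 0"
        then have "(i, j) = (k - j, j)" using ij(1) by simp
        then show False using ij by auto
      qed
      then show "c i j * 0 ^ (k - i - j) * s ^ i * t ^ j = 0" by simp
    qed
  qed auto
  then show ?thesis by (simp add: sum.reindex inj_on_def)
qed

text \<open>Passing from \<open>r\<close> to \<open>Suc r\<close> adds the diagonal
  \<open>i + j = Suc r\<close>, which has \<open>Suc r\<close> points with \<open>1 \<le> i\<close>.
  The factor 2 avoids division on natural numbers.\<close>

lemma card_pos_exps: "2 * card {(i, j). 1 \<le> i \<and> i + j \<le> r} = r * (r + 1)"
proof (induction r)
  case 0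
  have "{(i, j). 1 \<le> i \<and> i + j \<le> (0::nat)} = {}" by auto
  then show ?case by (simp only: card.empty)
next
  case (Suc r)
  let ?A = "{(i, j). 1 \<le> i \<and> i + j \<le> r}" and ?B = "(\<lambda>j. (Suc r - j, j)) ` {..r}"
  have "{(i, j). 1 \<le> i \<and> i + j \<le> Suc r} = ?A \<union> ?B"
    by (auto simp: image_iff)
  moreover have "finite ?A" by (rule finite_subset[of _ "exps r"]) auto
  moreover have "?A \<inter> ?B = {}" by auto
  moreover have "card ?B = Suc r"
    by (subst card_image) (auto simp: inj_on_def)
  ultimately have "card {(i, j). 1 \<le> i \<and> i + j \<le> Suc r} = card ?A + Suc r"
    by (simp only: card_Un_disjoint finite_imageI finite_atMost)
  then have "2 * card {(i, j). 1 \<le> i \<and> i + j \<le> Suc r} = r * (r + 1) + 2 * Suc r"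
    unfolding Suc[symmetric] by (simp only: distrib_left)
  then show ?case by simp
qed

text \<open>Division by \<open>N = 1 + s + t\<close> carries the quadrant into the reference
  triangle, and there the third coordinate is \<open>1 / N\<close>. Multiplying by
  \<open>N ^ k\<close> turns the Bernstein sum into an ordinary polynomial in \<open>s\<close> and
  \<open>t\<close> that vanishes on the quadrant; counting roots first in \<open>s\<close>, then in
  \<open>t\<close>, kills every coefficient.\<close>

lemma form_indep:
  assumes zero: "\<And>s t. 0 \<le> s \<Longrightarrow> 0 \<le> t \<Longrightarrow> s + t \<le> 1 \<Longrightarrow>
      (\<Sum>(i, j)\<in>exps k. c i j * (1 - s - t) ^ (k - i - j) * s ^ i * t ^ j) = (0::real)"
    and ij: "i + j \<le> k"
  shows "c i j = 0"
proof -
  have dehom: "(\<Sum>(i, j)\<in>exps k. c i j * s ^ i * t ^ j) = 0" if "0 \<le> s" "0 \<le> t" for s t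
  proof -
    define N where "N = 1 + s + t"
    have N: "N > 0" using that by (simp add: N_def)
    have "1 - s / N - t / N = (N - s - t) / N" using N by (simp add: diff_divide_distrib)
    then have m: "1 - s / N - t / N = 1 / N" by (simp add: N_def)
    have le: "s / N + t / N \<le> 1"
      using N by (simp add: add_divide_distrib[symmetric] divide_le_eq_1) (simp add: N_def)
    have "0 = N ^ k * (\<Sum>(i, j)\<in>exps k. c i j * (1 - s / N - t / N) ^ (k - i - j) * (s / N) ^ i * (t / N) ^ j)"
      using zero[of "s / N" "t / N"] that N le by simp
    also have "\<dots> = (\<Sum>(i, j)\<in>exps k. c i j * s ^ i * t ^ j)"
      unfolding sum_distrib_left m
    proof (intro sum.cong refl, clarify)
      fix i j assume "i + j \<le> k"
      then have "N ^ k = N ^ (k - i - j) * N ^ i * N ^ j"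
        by (simp add: power_add[symmetric])
      then show "N ^ k * (c i j * (1 / N) ^ (k - i - j) * (s / N) ^ i * (t / N) ^ j) = c i j * s ^ i * t ^ j"
        using N by (simp add: power_divide)
    qed
    finally show ?thesis by simp
  qed
  have unfold: "(\<Sum>(i, j)\<in>exps k. c i j * s ^ i * t ^ j)
     = (\<Sum>i\<le>k. (\<Sum>j\<le>k - i. c i j * t ^ j) * s ^ i)" for s t
  proof -
    have "exps k = (SIGMA i:{..k}. {..k - i})" by auto
    then show ?thesis by (simp add: sum.Sigma[symmetric] sum_distrib_left sum_distrib_right ac_simps)
  qed
  have inf: "infinite {0..1::real}" by simp
  have "(\<Sum>j\<le>k - i. c i j * t ^ j) = 0" if "0 \<le> t" for t
  proof (rule ccontr)
    assume "\<not> ?thesis"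
    with ij have "finite {s. (\<Sum>i\<le>k. (\<Sum>j\<le>k - i. c i j * t ^ j) * s ^ i) = 0}"
      by (intro polyfun_rootbound_finite exI[of _ i]) auto
    moreover have "{0..1} \<subseteq> {s. (\<Sum>i\<le>k. (\<Sum>j\<le>k - i. c i j * t ^ j) * s ^ i) = 0}"
      using dehom that unfolding unfold by auto
    ultimately show False using inf finite_subset by blast
  qed
  note inner = this
  show ?thesis
  proof (rule ccontr)
    assume "c i j \<noteq> 0"
    with ij have "finite {t. (\<Sum>j\<le>k - i. c i j * t ^ j) = 0}"
      by (intro polyfun_rootbound_finite exI[of _ j]) auto
    moreover have "{0..1} \<subseteq> {t. (\<Sum>j\<le>k - i. c i j * t ^ j) = 0}"
      using inner by auto
    ultimately show False using inf finite_subset by blast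
  qed
qed

text \<open>The same rescaling in one variable, with \<open>N = 1 + t\<close>.\<close>

lemma bernstein_indep:
  assumes zero: "\<And>t. 0 \<le> t \<Longrightarrow> t \<le> 1 \<Longrightarrow> (\<Sum>j\<le>k. c j * (1 - t) ^ (k - j) * t ^ j) = (0::real)"
    and j: "j \<le> k"
  shows "c j = 0"
proof (rule ccontr)
  assume nz: "c j \<noteq> 0"
  have "(\<Sum>j\<le>k. c j * t ^ j) = 0" if "0 \<le> t" for t
  proof -
    define N where "N = 1 + t"
    have N: "N > 0" using that by (simp add: N_def)
    have "1 - t / N = (N - t) / N" using N by (simp add: diff_divide_distrib)
    then have m: "1 - t / N = 1 / N" by (simp add: N_def)
    have le: "t / N \<le> 1" using N by (simp add: divide_le_eq_1) (simp add: N_def)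
    have "0 = N ^ k * (\<Sum>j\<le>k. c j * (1 - t / N) ^ (k - j) * (t / N) ^ j)"
      using zero[of "t / N"] that N le by simp
    also have "\<dots> = (\<Sum>j\<le>k. c j * t ^ j)"
      unfolding sum_distrib_left m
    proof (intro sum.cong refl)
      fix j assume "j \<in> {..k}"
      then have "N ^ k = N ^ (k - j) * N ^ j"
        by (simp add: power_add[symmetric])
      then show "N ^ k * (c j * (1 / N) ^ (k - j) * (t / N) ^ j) = c j * t ^ j"
        using N by (simp add: power_divide)
    qed
    finally show ?thesis by simp
  qed
  then have "{0..1} \<subseteq> {t. (\<Sum>j\<le>k. c j * t ^ j) = 0}" by auto
  moreover have "finite {t. (\<Sum>j\<le>k. c j * t ^ j) = 0}"
    using nz j by (intro polyfun_rootbound_finite exI[of _ j]) auto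
  moreover have "infinite {0..1::real}" by simp
  ultimately show False using finite_subset by blast
qed

section \<open>Integrals and edge polynomials\<close>

lemma continuous_on_compact_integrable:
  fixes f :: "'a::euclidean_space \<Rightarrow> 'b::euclidean_space"
  assumes "compact T" "continuous_on T f"
  shows "f integrable_on T"
proof -
  have "(\<lambda>x. indicator T x *\<^sub>R f x) integrable_on UNIV"
    by (intro integrable_on_lborel borel_integrable_compact assms)
  moreover have "(\<lambda>x. indicator T x *\<^sub>R f x) = (\<lambda>x. if x \<in> T then f x else 0)"
    by auto
  ultimately show ?thesis by (simp add: integrable_restrict_UNIV)
qed

text \<open>Around an interior point there is a box inside \<open>T\<close>; the integral over it
  lies between 0 and the integral over \<open>T\<close>, so \<open>f\<close> vanishes on the box.
  The interior is dense in a closed convex set with nonempty interior, and continuity does the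
  rest.\<close>

lemma integral_eq_0_imp_eq_0:
  fixes f :: "'a::euclidean_space \<Rightarrow> real"
  assumes T: "compact T" "convex T" "interior T \<noteq> {}"
    and cont: "continuous_on T f" and nonneg: "\<And>x. x \<in> T \<Longrightarrow> 0 \<le> f x"
    and int: "integral T f = 0" and x: "x \<in> T"
  shows "f x = 0"
proof -
  have cl: "closure (interior T) = T"
    using T by (simp add: convex_closure_interior compact_imp_closed)
  have "f y = 0" if y: "y \<in> interior T" for y
  proof -
    obtain a b where ab: "cbox a b \<subseteq> interior T" "y \<in> box a b"
      using open_contains_cbox[OF open_interior y] by metis
    have sub: "cbox a b \<subseteq> T" using ab interior_subset by blast
    have contab: "continuous_on (cbox a b) f" using cont sub continuous_on_subset by blast
    have "integral (cbox a b) f \<le> integral T f"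
      using sub nonneg
      by (intro integral_subset_le integrable_continuous contab continuous_on_compact_integrable T cont) auto
    moreover have "0 \<le> integral (cbox a b) f"
      using sub nonneg by (intro integral_nonneg integrable_continuous contab) auto
    ultimately have "integral (cbox a b) f = 0" using int by simp
    moreover have "y \<in> cbox a b" using ab(2) box_subset_cbox by blast
    ultimately show ?thesis
      using integral_cbox_eq_0_iff[OF contab] ab(2) nonneg sub by blast
  qed
  then show ?thesis
    using continuous_constant_on_closure[of "interior T" f 0 x] cl cont x by simp
qed

lemma form_segment:
  assumes "form k g"
  obtains c where "\<And>t. g 1 (linepath a b t $ 1) (linepath a b t $ 2)
     = (\<Sum>j\<le>k. c j * (1 - t) ^ (k - j) * t ^ j)"
proof -
  \<comment> \<open>The variable \<open>s\<close> is a dummy that only brings the count to three: it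
    is set to 0 below, while \<open>m\<close> becomes \<open>1 - t\<close>, so the arguments of
    \<open>g\<close> become 1 and the coordinates of \<open>linepath a b t\<close>.\<close>
  have "form k (\<lambda>m s t. g (1 * m + 1 * s + 1 * t) (a $ 1 * m + a $ 1 * s + b $ 1 * t)
     (a $ 2 * m + a $ 2 * s + b $ 2 * t))"
    by (rule form_subst[OF assms form_linear form_linear form_linear])
  then obtain c where c: "(\<lambda>m s t. g (1 * m + 1 * s + 1 * t) (a $ 1 * m + a $ 1 * s + b $ 1 * t)
     (a $ 2 * m + a $ 2 * s + b $ 2 * t))
     = (\<lambda>m s t. \<Sum>(i, j)\<in>exps k. c i j * m ^ (k - i - j) * s ^ i * t ^ j)"
    unfolding form_iff by blast
  show ?thesis
  proof (rule that[of "c 0"])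
    fix t
    have "g 1 (linepath a b t $ 1) (linepath a b t $ 2)
      = (\<Sum>(i, j)\<in>exps k. c i j * (1 - t) ^ (k - i - j) * 0 ^ i * t ^ j)"
      using fun_cong[OF fun_cong[OF fun_cong[OF c, of "1 - t"], of 0], of t]
      by (simp add: linepath_def algebra_simps)
    also have "\<dots> = (\<Sum>j\<le>k. c 0 j * (1 - t) ^ (k - j) * t ^ j)"
      by (rule sum_exps_s0)
    finally show "g 1 (linepath a b t $ 1) (linepath a b t $ 2)
      = (\<Sum>j\<le>k. c 0 j * (1 - t) ^ (k - j) * t ^ j)" .
  qed
qed

text \<open>Converse of \<open>form_segment\<close>: every one-variable polynomial in the segment
  parameter is the trace of a polynomial of the plane of the same degree.\<close>

lemma bernstein_poly_on_segment:
  fixes a b :: "real^2"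
  assumes "a \<noteq> b"
  obtains g where "form k g"
    "\<And>t. g 1 (linepath a b t $ 1) (linepath a b t $ 2)
      = (\<Sum>j\<le>k. c j * (1 - t) ^ (k - j) * t ^ j)"
proof -
  define d where "d = b - a"
  define w where "w = inner d d"
  have w: "w > 0" using assms by (simp add: w_def d_def)
  \<comment> \<open>Homogenization of the affine function that sends x to the inner product of x - a
    and b - a, divided by the squared length of b - a. On the line through the endpoints it returns
    the parameter \<open>t\<close>.\<close>
  define p where "p = (\<lambda>m s t. (- inner a d / w) * m + (d $ 1 / w) * s + (d $ 2 / w) * t)"
  have p: "p 1 (linepath a b t $ 1) (linepath a b t $ 2) = t" for t
  proof -
    have "linepath a b t = a + t *\<^sub>R d" by (simp add: linepath_def d_def algebra_simps)
    then have "- inner a d + d $ 1 * (linepath a b t $ 1) + d $ 2 * (linepath a b t $ 2) = t * w"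
      by (simp add: inner_vec_def sum_2 w_def algebra_simps)
    moreover have "p 1 X Y = (- inner a d + d $ 1 * X + d $ 2 * Y) / w" for X Y
      by (simp add: p_def add_divide_distrib diff_divide_distrib)
    ultimately have "p 1 (linepath a b t $ 1) (linepath a b t $ 2) = (t * w) / w"
      by simp
    then show ?thesis using w by simp
  qed
  have "form 1 p" "form 1 (\<lambda>m s t. (1 + inner a d / w) * m + (- d $ 1 / w) * s + (- d $ 2 / w) * t)"
    unfolding p_def by (rule form_linear)+
  moreover have "(\<lambda>m s t. (1 + inner a d / w) * m + (- d $ 1 / w) * s + (- d $ 2 / w) * t)
     = (\<lambda>m s t. m - p m s t)"
    by (simp add: p_def fun_eq_iff algebra_simps)
  ultimately have f: "form 1 p" "form 1 (\<lambda>m s t. m - p m s t)" by simp_all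
  have "form k (\<lambda>m s t. c j * ((m - p m s t) ^ (k - j) * p m s t ^ j))" if "j \<le> k" for j
    using form_mult[OF form_power[OF f(1), of j] form_power[OF f(2), of "k - j"]] that
    by (intro form_cmult) simp
  then have "form k (\<lambda>m s t. \<Sum>j\<le>k. c j * ((m - p m s t) ^ (k - j) * p m s t ^ j))"
    by (intro form_sum) auto
  then show ?thesis
    by (rule that) (simp add: p mult.assoc)
qed

lemma closed_segment_eq_linepath: "closed_segment a b = linepath a b ` {0..1}"
  by (simp add: linepath_image_01)

text \<open>Different polynomials in two variables may agree on the segment, so the count uses the
  Bernstein polynomials of degree \<open>r - 2\<close> in the parameter. For \<open>r < 2\<close>
  the degree is negative, the space is zero, and \<open>r - 1\<close> is 0 as well.\<close>

lemma dim_polys_on_segment: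
  fixes a b :: "real^2"
  assumes "a \<noteq> b"
  shows "fun_space.dim (polys_on (int r - 2) (closed_segment a b)) = r - 1"
proof (cases "r \<ge> 2")
  case False
  then have "polys_on (int r - 2) (closed_segment a b) = {\<lambda>x. 0}"
    by (intro polys_on_neg) simp
  then show ?thesis using False
    by (subst fun_space_dim_eq_card[where I = "{}" and f = "\<lambda>_. undefined"]) auto
next
  case True
  define k where "k = r - 2"
  have k: "int r - 2 = int k" "r - 1 = Suc k" using True by (auto simp: k_def)
  have "\<exists>f. f \<in> polys_on (int k) (closed_segment a b) \<and>
     (\<forall>t\<in>{0..1}. f (linepath a b t) = (1 - t) ^ (k - i) * t ^ i)" if "i \<le> k" for i
  proof -
    from bernstein_poly_on_segment[OF assms, of k "\<lambda>j. if j = i then 1 else 0"]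
    obtain g where g: "form k g" "\<And>t. g 1 (linepath a b t $ 1) (linepath a b t $ 2)
      = (\<Sum>j\<le>k. (if j = i then 1 else 0) * (1 - t) ^ (k - j) * t ^ j)"
      by blast
    have "(\<Sum>j\<le>k. (if j = i then 1 else 0) * (1 - t) ^ (k - j) * t ^ j)
        = (\<Sum>j\<le>k. if j = i then (1 - t) ^ (k - j) * t ^ j else 0)" for t :: real
      by (rule sum.cong) auto
    with g that show ?thesis
      by (intro exI[of _ "restrict0 (closed_segment a b) (\<lambda>x. g 1 (x $ 1) (x $ 2))"])
        (auto simp: polys_on_eq_forms restrict0_def closed_segment_eq_linepath)
  qed
  then obtain f where f: "\<And>i. i \<le> k \<Longrightarrow> f i \<in> polys_on (int k) (closed_segment a b)"
    "\<And>i t. i \<le> k \<Longrightarrow> t \<in> {0..1} \<Longrightarrow> f i (linepath a b t) = (1 - t) ^ (k - i) * t ^ i"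
    by metis
  have "fun_space.dim (polys_on (int k) (closed_segment a b)) = card {..k}"
  proof (rule fun_space_dim_eq_card[where f = f])
    fix c i
    assume zero: "\<And>x. (\<Sum>i\<le>k. c i * f i x) = 0" and i: "i \<in> {..k}"
    show "c i = 0"
    proof (rule bernstein_indep)
      fix t :: real assume "0 \<le> t" "t \<le> 1"
      then show "(\<Sum>j\<le>k. c j * (1 - t) ^ (k - j) * t ^ j) = 0"
        using zero[of "linepath a b t"] f(2)[of _ t] by (simp add: mult.assoc)
    qed (use i in auto)
  next
    fix q assume "q \<in> polys_on (int k) (closed_segment a b)"
    then obtain g where g: "form k g"
        "q = restrict0 (closed_segment a b) (\<lambda>x. g 1 (x $ 1) (x $ 2))"
      by (auto simp: polys_on_eq_forms)
    obtain c where c: "\<And>t. g 1 (linepath a b t $ 1) (linepath a b t $ 2)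
      = (\<Sum>j\<le>k. c j * (1 - t) ^ (k - j) * t ^ j)"
      using form_segment[OF g(1)] by blast
    have "q x = (\<Sum>i\<le>k. c i * f i x)" for x
    proof (cases "x \<in> closed_segment a b")
      case True
      then obtain t where "t \<in> {0..1}" "x = linepath a b t"
        by (auto simp: closed_segment_eq_linepath)
      then show ?thesis using True f(2)[of _ t] by (simp add: g(2) restrict0_def c mult.assoc)
    next
      case False
      have "f i x = 0" if "i \<le> k" for i
        using f(1)[OF that] False by (auto simp: polys_on_eq_forms restrict0_def)
      then show ?thesis using False by (simp add: g(2) restrict0_def)
    qed
    then show "\<exists>c. \<forall>x. q x = (\<Sum>i\<le>k. c i * f i x)" by blast
  qed (use f in auto)
  then show ?thesis unfolding k by simp
qed

lemma zero_on_segment: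
  fixes a b :: "real^2"
  assumes ab: "a \<noteq> b" and "r \<ge> 1"
    and q: "\<And>t. t \<in> {0..1} \<Longrightarrow>
      q (linepath a b t) = (\<Sum>j\<le>r. c j * (1 - t) ^ (r - j) * t ^ j)"
    and ends: "q a = 0" "q b = 0"
    and orth: "\<And>p. p \<in> polys_on (int r - 2) (closed_segment a b) \<Longrightarrow>
      edge_integral a b (\<lambda>x. q x * p x) = 0"
    and x: "x \<in> closed_segment a b"
  shows "q x = 0"
proof -
  \<comment> \<open>The values of a Bernstein sum at the endpoints are its extreme
    coefficients.\<close>
  have c0: "c 0 = 0"
  proof -
    have "(\<Sum>j\<le>r. c j * (1 - 0) ^ (r - j) * 0 ^ j) = (\<Sum>j\<in>{0}. c j * (1 - 0) ^ (r - j) * 0 ^ j)"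
      by (rule sum.mono_neutral_right) auto
    then show ?thesis using q[of 0] ends by (simp add: linepath_def)
  qed
  have cr: "c r = 0"
  proof -
    have "(\<Sum>j\<le>r. c j * (1 - 1) ^ (r - j) * 1 ^ j) = (\<Sum>j\<in>{r}. c j * (1 - 1) ^ (r - j) * 1 ^ j)"
      by (rule sum.mono_neutral_right) auto
    then show ?thesis using q[of 1] ends by (simp add: linepath_def)
  qed
  show ?thesis
  proof (cases "r = 1")
    case True
    then have "c j = 0" if "j \<le> r" for j
      using that c0 cr by (cases j) auto
    then show ?thesis using x q by (auto simp: closed_segment_eq_linepath)
  next
    case False
    define k where "k = r - 2"
    have r: "r = Suc (Suc k)" using False \<open>r \<ge> 1\<close> by (simp add: k_def)
    \<comment> \<open>The quotient of \<open>q\<close> by \<open>t * (1 - t)\<close> on the edge: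
      once the extreme coefficients are gone, dividing is a shift of the index by one.\<close>
    define h where "h t = (\<Sum>j\<le>k. c (Suc j) * (1 - t) ^ (k - j) * t ^ j)" for t :: real
    have qh: "q (linepath a b t) = (1 - t) * t * h t" if "t \<in> {0..1}" for t
    proof -
      have "q (linepath a b t) = (\<Sum>j\<in>Suc ` {..k}. c j * (1 - t) ^ (r - j) * t ^ j)"
        unfolding q[OF that]
      proof (rule sum.mono_neutral_right)
        show "\<forall>i\<in>{..r} - Suc ` {..k}. c i * (1 - t) ^ (r - i) * t ^ i = 0"
        proof
          fix i assume i: "i \<in> {..r} - Suc ` {..k}"
          then have "i = 0 \<or> i = r" unfolding r by (cases i) auto
          then show "c i * (1 - t) ^ (r - i) * t ^ i = 0" using c0 cr by auto
        qed
      qed (auto simp: r)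
      also have "\<dots> = (1 - t) * t * h t"
        by (simp add: sum.reindex h_def sum_distrib_left r Suc_diff_le) (rule sum.cong; simp)
      finally show ?thesis .
    qed
    obtain g where g: "form k g" "\<And>t. g 1 (linepath a b t $ 1) (linepath a b t $ 2) = h t"
      using bernstein_poly_on_segment[OF ab, of k "\<lambda>j. c (Suc j)"] unfolding h_def by blast
    define p where "p = restrict0 (closed_segment a b) (\<lambda>x. g 1 (x $ 1) (x $ 2))"
    have "p \<in> polys_on (int r - 2) (closed_segment a b)"
      using g(1) polys_on_eq_forms[of k] unfolding p_def r by auto
    then have "edge_integral a b (\<lambda>x. q x * p x) = 0" by (rule orth)
    then have "integral {0..1} (\<lambda>t. q (linepath a b t) * p (linepath a b t)) = 0"
      using ab by (simp add: edge_integral_def)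
    moreover have "integral {0..1} (\<lambda>t. q (linepath a b t) * p (linepath a b t))
        = integral {0..1} (\<lambda>t. (1 - t) * t * (h t)\<^sup>2)"
      by (rule integral_cong)
        (simp add: qh p_def restrict0_def closed_segment_eq_linepath g(2) power2_eq_square)
    ultimately have "integral {0..1} (\<lambda>t. (1 - t) * t * (h t)\<^sup>2) = 0"
      by simp
    moreover have "continuous_on {0..1} (\<lambda>t. (1 - t) * t * (h t)\<^sup>2)"
      unfolding h_def by (intro continuous_intros)
    ultimately have "\<forall>t\<in>{0..1}. (1 - t) * t * (h t)\<^sup>2 = 0"
      by (subst (asm) integral_eq_0_iff) auto
    \<comment> \<open>A zero of the weighted square is a zero of \<open>(1 - t) * t * h t\<close>,
      also at the endpoints, so nothing has to be said about \<open>h\<close> there.\<close>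
    then show ?thesis using x qh by (auto simp: closed_segment_eq_linepath)
  qed
qed

section \<open>Piecewise polynomials on a fan of triangles\<close>

text \<open>A closed chain of triangles around \<open>ctr\<close>, with \<open>lam k\<close> the hat
  function of the boundary vertex \<open>v k\<close>. Its prescribed values in the local coordinates
  of every triangle also encode that the triangles are nondegenerate and that coordinates agree on
  common points. The condition \<open>nx (nx k) \<noteq> k\<close> excludes a fan of two triangles:
  thanks to it, \<open>lam (nx l) * lam (nx (nx l))\<close> vanishes on triangle
  \<open>l\<close>.\<close>

locale fan =
  fixes K :: "'i set" and nx :: "'i \<Rightarrow> 'i" and k0 :: 'i
    and ctr :: "real^2" and v :: "'i \<Rightarrow> real^2" and T :: "(real^2) set"
    and lam :: "'i \<Rightarrow> real^2 \<Rightarrow> real"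
  assumes finite_K: "finite K" and k0: "k0 \<in> K"
    and nx: "k \<in> K \<Longrightarrow> nx k \<in> K" "k \<in> K \<Longrightarrow> nx k \<noteq> k" "k \<in> K \<Longrightarrow> nx (nx k) \<noteq> k"
    and T_eq: "T = (\<Union>k\<in>K. convex hull {ctr, v k, v (nx k)})"
    and frontier_T: "frontier T = (\<Union>k\<in>K. closed_segment (v k) (v (nx k)))"
    and convex_T: "convex T" and ctr: "ctr \<in> interior T"
    and continuous_lam: "k \<in> K \<Longrightarrow> continuous_on T (lam k)"
    and lam_eval: "k \<in> K \<Longrightarrow> l \<in> K \<Longrightarrow> 0 \<le> s \<Longrightarrow> 0 \<le> t \<Longrightarrow> s + t \<le> 1 \<Longrightarrow>
      lam k (ctr + s *\<^sub>R (v l - ctr) + t *\<^sub>R (v (nx l) - ctr))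
        = (if k = l then s else if k = nx l then t else 0)"
begin

definition pt :: "'i \<Rightarrow> real \<Rightarrow> real \<Rightarrow> real^2" where
  "pt l s t = ctr + s *\<^sub>R (v l - ctr) + t *\<^sub>R (v (nx l) - ctr)"

definition tri :: "'i \<Rightarrow> (real^2) set" where
  "tri l = convex hull {ctr, v l, v (nx l)}"

definition lam0 :: "real^2 \<Rightarrow> real" where
  "lam0 x = 1 - (\<Sum>k\<in>K. lam k x)"

definition fan_space :: "nat \<Rightarrow> (real^2 \<Rightarrow> real) set" where
  "fan_space r = {q. continuous_on T q \<and> (\<forall>x. x \<notin> T \<longrightarrow> q x = 0) \<and>
     (\<forall>l\<in>K. restrict0 (tri l) q \<in> polys_on (int r) (tri l))}"

definition fan_space0 :: "nat \<Rightarrow> (real^2 \<Rightarrow> real) set" where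
  "fan_space0 r = {q \<in> fan_space r. (\<forall>x\<in>frontier T. q x = 0) \<and> integral T q = 0}"

definition basis_fun :: "nat \<Rightarrow> 'i \<times> nat \<times> nat \<Rightarrow> real^2 \<Rightarrow> real" where
  "basis_fun r = (\<lambda>(k, i, j). restrict0 T (\<lambda>x. lam0 x ^ (r - i - j) * lam k x ^ i * lam (nx k) x ^ j))"

text \<open>Exponents with \<open>i = 0\<close> would only repeat functions:
  \<open>(k, 0, j)\<close> gives the same product as \<open>(nx k, j, 0)\<close>, and
  \<open>(k, 0, 0)\<close> gives the same power of \<open>lam0\<close> for all \<open>k\<close>,
  represented here by \<open>k0\<close>.\<close>

definition idx :: "nat \<Rightarrow> ('i \<times> nat \<times> nat) set" where
  "idx r = insert (k0, 0, 0) {(k, i, j). k \<in> K \<and> 1 \<le> i \<and> i + j \<le> r}"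

text \<open>On the triangle \<open>l\<close> the Bernstein monomial with exponents \<open>(i, j)\<close> is the
  restriction of the basis function with index \<open>glob l (i, j)\<close>; all other basis functions vanish there.\<close>

definition glob :: "'i \<Rightarrow> nat \<times> nat \<Rightarrow> 'i \<times> nat \<times> nat" where
  "glob l = (\<lambda>(i, j). if 1 \<le> i then (l, i, j) else if 1 \<le> j then (nx l, j, 0) else (k0, 0, 0))"

section \<open>Local coordinates on the triangles of a fan\<close>

lemma tri_eq: "tri l = {pt l s t | s t. 0 \<le> s \<and> 0 \<le> t \<and> s + t \<le> 1}"
  unfolding tri_def pt_def convex_hull_3_alt ..

lemma pt_in_T: "l \<in> K \<Longrightarrow> 0 \<le> s \<Longrightarrow> 0 \<le> t \<Longrightarrow> s + t \<le> 1 \<Longrightarrow> pt l s t \<in> T"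
  using tri_eq[of l] unfolding T_eq tri_def by blast

lemma tri_subset: "l \<in> K \<Longrightarrow> tri l \<subseteq> T"
  unfolding T_eq tri_def by blast

lemma T_cases:
  assumes "x \<in> T"
  obtains l s t where "l \<in> K" "0 \<le> s" "0 \<le> t" "s + t \<le> 1" "x = pt l s t"
  using assms tri_eq unfolding T_eq tri_def by blast

lemma compact_T: "compact T"
  unfolding T_eq using finite_K by (intro compact_UN) (auto intro: finite_imp_compact_convex_hull)

lemma lam_pt:
  "k \<in> K \<Longrightarrow> l \<in> K \<Longrightarrow> 0 \<le> s \<Longrightarrow> 0 \<le> t \<Longrightarrow> s + t \<le> 1 \<Longrightarrow>
     lam k (pt l s t) = (if k = l then s else if k = nx l then t else 0)"
  unfolding pt_def by (rule lam_eval)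

lemma lam0_pt:
  assumes "l \<in> K" "0 \<le> s" "0 \<le> t" "s + t \<le> 1"
  shows "lam0 (pt l s t) = 1 - s - t"
proof -
  have "(\<Sum>k\<in>K. lam k (pt l s t)) = (\<Sum>k\<in>{l, nx l}. lam k (pt l s t))"
    using assms nx finite_K by (intro sum.mono_neutral_right) (auto simp: lam_pt)
  also have "\<dots> = s + t"
    using assms nx[of l] nx(2)[of l, symmetric] by (simp add: lam_pt)
  finally show ?thesis by (simp add: lam0_def)
qed

lemma lam0_nonneg: "x \<in> T \<Longrightarrow> 0 \<le> lam0 x"
  by (elim T_cases) (simp add: lam0_pt)

lemma continuous_lam0: "continuous_on T lam0"
  unfolding lam0_def by (intro continuous_intros continuous_lam)

text \<open>A linear relation would allow the local coordinates \<open>(1/4, 1/4)\<close> to be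
  moved along \<open>(\<alpha>, \<beta>)\<close> without moving the point, although
  \<open>lam l\<close> and \<open>lam (nx l)\<close> read the coordinates off. The factor
  \<open>c\<close> keeps each shift at most 1/4, hence inside the triangle.\<close>

lemma edges_indep:
  assumes l: "l \<in> K" and eq: "\<alpha> *\<^sub>R (v l - ctr) + \<beta> *\<^sub>R (v (nx l) - ctr) = 0"
  shows "\<alpha> = 0" "\<beta> = 0"
proof -
  define c where "c = 1 / (4 * (1 + \<bar>\<alpha>\<bar> + \<bar>\<beta>\<bar>))"
  have c: "c > 0" by (simp add: c_def)
  have "\<bar>c * \<alpha>\<bar> \<le> 1 / 4" "\<bar>c * \<beta>\<bar> \<le> 1 / 4"
    by (simp_all add: c_def abs_mult field_simps)
  then have "0 \<le> 1 / 4 + c * \<alpha>" "0 \<le> 1 / 4 + c * \<beta>" "1 / 4 + c * \<alpha> + (1 / 4 + c * \<beta>) \<le> 1"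
    by linarith+
  note b = lam_pt[OF _ l this]
  have "pt l (1 / 4 + c * \<alpha>) (1 / 4 + c * \<beta>)
      = pt l (1 / 4) (1 / 4) + c *\<^sub>R (\<alpha> *\<^sub>R (v l - ctr) + \<beta> *\<^sub>R (v (nx l) - ctr))"
    by (simp add: pt_def scaleR_add_left scaleR_add_right)
  then have *: "pt l (1 / 4 + c * \<alpha>) (1 / 4 + c * \<beta>) = pt l (1 / 4) (1 / 4)" using eq by simp
  show "\<alpha> = 0" using b[OF l] lam_pt[OF l l, of "1/4" "1/4"] c * by simp
  show "\<beta> = 0" using b[OF nx(1)[OF l]] lam_pt[OF nx(1)[OF l] l, of "1/4" "1/4"] c * nx(2)[OF l] by simp
qed

lemma coord_forms:
  assumes l: "l \<in> K"
  obtains S U where "form 1 S" "form 1 U"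
    "\<And>s t. S 1 (pt l s t $ 1) (pt l s t $ 2) = s" "\<And>s t. U 1 (pt l s t $ 1) (pt l s t $ 2) = t"
proof -
  define a where "a = v l - ctr"
  define b where "b = v (nx l) - ctr"
  define D where "D = a $ 1 * b $ 2 - a $ 2 * b $ 1"
  have D: "D \<noteq> 0"
  proof
    assume D0: "D = 0"
    \<comment> \<open>With zero determinant these combinations vanish in both coordinates;
      independence then gives \<open>b = 0\<close>, which is itself a relation.\<close>
    have "(b $ 1) *\<^sub>R a + (- a $ 1) *\<^sub>R b = 0" "(b $ 2) *\<^sub>R a + (- a $ 2) *\<^sub>R b = 0"
      using D0 by (simp_all add: vec_eq_iff forall_2 D_def algebra_simps)
    then have "b $ 1 = 0" "b $ 2 = 0" using edges_indep(1)[OF l] unfolding a_def b_def by blast+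
    then have "b = 0" by (simp add: vec_eq_iff forall_2)
    then have "0 *\<^sub>R a + 1 *\<^sub>R b = 0" by simp
    then show False using edges_indep(2)[OF l, of 0 1] by (simp add: a_def b_def)
  qed
  \<comment> \<open>Cramer's rule, with the constant terms attached to the first variable.\<close>
  define S where "S = (\<lambda>m s t. ((ctr $ 2 * b $ 1 - ctr $ 1 * b $ 2) / D) * m + (b $ 2 / D) * s + (- b $ 1 / D) * t)"
  define U where "U = (\<lambda>m s t. ((ctr $ 1 * a $ 2 - ctr $ 2 * a $ 1) / D) * m + (- a $ 2 / D) * s + (a $ 1 / D) * t)"
  have x: "pt l s t = ctr + s *\<^sub>R a + t *\<^sub>R b" for s t by (simp add: pt_def a_def b_def)
  show ?thesis
  proof
    show "form 1 S" "form 1 U" unfolding S_def U_def by (rule form_linear)+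
    fix s t
    have "S 1 (pt l s t $ 1) (pt l s t $ 2) = (s * D) / D"
      unfolding S_def x using D by (simp add: divide_simps) (simp add: D_def algebra_simps)
    then show "S 1 (pt l s t $ 1) (pt l s t $ 2) = s" using D by simp
    have "U 1 (pt l s t $ 1) (pt l s t $ 2) = (t * D) / D"
      unfolding U_def x using D by (simp add: divide_simps) (simp add: D_def algebra_simps)
    then show "U 1 (pt l s t $ 1) (pt l s t $ 2) = t" using D by simp
  qed
qed

lemma lam_form:
  assumes "k \<in> K" "l \<in> K"
  obtains g where "form 1 g" "\<And>x. x \<in> tri l \<Longrightarrow> lam k x = g 1 (x $ 1) (x $ 2)"
proof -
  obtain S U where SU: "form 1 S" "form 1 U"
    "\<And>s t. S 1 (pt l s t $ 1) (pt l s t $ 2) = s" "\<And>s t. U 1 (pt l s t $ 1) (pt l s t $ 2) = t"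
    using coord_forms[OF assms(2)] by blast
  show ?thesis
    by (rule that[of "if k = l then S else if k = nx l then U else (\<lambda>m s t. 0)"])
      (use SU assms form_zero in \<open>auto simp: tri_eq lam_pt\<close>)
qed

lemma lam0_form:
  assumes "l \<in> K"
  obtains g where "form 1 g" "\<And>x. x \<in> tri l \<Longrightarrow> lam0 x = g 1 (x $ 1) (x $ 2)"
proof -
  obtain S U where SU: "form 1 S" "form 1 U"
    "\<And>s t. S 1 (pt l s t $ 1) (pt l s t $ 2) = s" "\<And>s t. U 1 (pt l s t $ 1) (pt l s t $ 2) = t"
    using coord_forms[OF assms] by blast
  have "form 1 (\<lambda>m s t. (1 * m + 0 * s + 0 * t) + (- 1) * S m s t + (- 1) * U m s t)"
    using SU by (intro form_add form_linear form_cmult)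
  then show ?thesis
    by (rule that) (use SU assms in \<open>auto simp: tri_eq lam0_pt\<close>)
qed

section \<open>The Bernstein basis of the fan space\<close>

lemma idx_D: "(k, i, j) \<in> idx r \<Longrightarrow> k \<in> K \<and> i + j \<le> r"
  using k0 by (auto simp: idx_def)

lemma finite_idx: "finite (idx r)"
proof -
  have "idx r \<subseteq> K \<times> exps r" using k0 by (auto simp: idx_def)
  then show ?thesis by (rule finite_subset) (use finite_K in simp)
qed

lemma basis_fun_outside: "x \<notin> T \<Longrightarrow> basis_fun r p x = 0"
  by (cases p) (simp add: basis_fun_def restrict0_def)

lemma basis_fun_mem:
  assumes "p \<in> idx r"
  shows "basis_fun r p \<in> fan_space r"
proof -
  obtain k i j where p: "p = (k, i, j)" by (cases p)
  have k: "k \<in> K" "nx k \<in> K" "i + j \<le> r" using assms nx(1) idx_D unfolding p by blast+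
  have "continuous_on T (basis_fun r p)"
  proof -
    have "continuous_on T (\<lambda>x. lam0 x ^ (r - i - j) * lam k x ^ i * lam (nx k) x ^ j)"
      by (intro continuous_intros continuous_lam continuous_lam0 k)
    then show ?thesis
      by (rule continuous_on_eq) (simp add: basis_fun_def p restrict0_def)
  qed
  moreover have "restrict0 (tri l) (basis_fun r p) \<in> polys_on (int r) (tri l)" if l: "l \<in> K" for l
  proof -
    obtain f where f: "form 1 f" "\<And>x. x \<in> tri l \<Longrightarrow> lam0 x = f 1 (x $ 1) (x $ 2)"
      using lam0_form[OF l] by blast
    obtain g where g: "form 1 g" "\<And>x. x \<in> tri l \<Longrightarrow> lam k x = g 1 (x $ 1) (x $ 2)"
      using lam_form[OF k(1) l] by blast
    obtain h where h: "form 1 h" "\<And>x. x \<in> tri l \<Longrightarrow> lam (nx k) x = h 1 (x $ 1) (x $ 2)"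
      using lam_form[OF k(2) l] by blast
    have "form (r - i - j + i + j) (\<lambda>m s t. f m s t ^ (r - i - j) * g m s t ^ i * h m s t ^ j)"
      using form_power[OF f(1), of "r - i - j"] form_power[OF g(1), of i] form_power[OF h(1), of j]
      by (intro form_mult) simp_all
    then have "form r (\<lambda>m s t. f m s t ^ (r - i - j) * g m s t ^ i * h m s t ^ j)"
      using k by simp
    moreover have "restrict0 (tri l) (basis_fun r p)
      = restrict0 (tri l) (\<lambda>x. (\<lambda>m s t. f m s t ^ (r - i - j) * g m s t ^ i * h m s t ^ j) 1 (x $ 1) (x $ 2))"
      using tri_subset[OF l] by (auto simp: restrict0_def basis_fun_def p f g h fun_eq_iff)
    ultimately show ?thesis unfolding polys_on_eq_forms
      by (intro CollectI exI[of _ "\<lambda>m s t. f m s t ^ (r - i - j) * g m s t ^ i * h m s t ^ j"] conjI)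
  qed
  ultimately show ?thesis
    by (simp add: fan_space_def basis_fun_outside)
qed

lemma basis_fun_pt:
  assumes "k \<in> K" "l \<in> K" "0 \<le> s" "0 \<le> t" "s + t \<le> 1"
  shows "basis_fun r (k, i, j) (pt l s t) = (1 - s - t) ^ (r - i - j)
    * (if k = l then s else if k = nx l then t else 0) ^ i
    * (if nx k = l then s else if nx k = nx l then t else 0) ^ j"
  using assms nx(1)[of k] by (simp add: basis_fun_def restrict0_def pt_in_T lam_pt lam0_pt)

lemma glob_in_idx: "l \<in> K \<Longrightarrow> p \<in> exps r \<Longrightarrow> glob l p \<in> idx r"
  using nx(1) by (auto simp: glob_def idx_def split: if_splits)

lemma inj_glob: "l \<in> K \<Longrightarrow> inj_on (glob l) (exps r)"
  using nx(2)[of l] by (auto simp: inj_on_def glob_def split: if_splits)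

text \<open>An index outside the image of \<open>glob l\<close> has \<open>1 \<le> i\<close> and
  \<open>k \<noteq> l\<close>. If also \<open>k \<noteq> nx l\<close>, then \<open>lam k\<close>
  vanishes on triangle \<open>l\<close>; if \<open>k = nx l\<close>, then \<open>1 \<le> j\<close>
  and \<open>lam (nx (nx l))\<close> vanishes there.\<close>

lemma sum_basis_fun_pt:
  assumes l: "l \<in> K" and st: "0 \<le> s" "0 \<le> t" "s + t \<le> 1"
  shows "(\<Sum>p\<in>idx r. a p * basis_fun r p (pt l s t))
    = (\<Sum>(i, j)\<in>exps r. a (glob l (i, j)) * (1 - s - t) ^ (r - i - j) * s ^ i * t ^ j)"
proof -
  have "(\<Sum>p\<in>idx r. a p * basis_fun r p (pt l s t))
    = (\<Sum>p\<in>glob l ` exps r. a p * basis_fun r p (pt l s t))"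
  proof (rule sum.mono_neutral_right)
    show "\<forall>p\<in>idx r - glob l ` exps r. a p * basis_fun r p (pt l s t) = 0"
    proof
      fix p assume p: "p \<in> idx r - glob l ` exps r"
      obtain k i j where pe: "p = (k, i, j)" by (cases p)
      have kij: "k \<in> K" "i + j \<le> r" using idx_D p pe by auto
      have "(k0, 0, 0) \<in> glob l ` exps r"
        by (rule image_eqI[of _ _ "(0, 0)"]) (auto simp: glob_def)
      then have i: "i \<ge> 1" using p pe by (auto simp: idx_def)
      have "(l, i, j) \<in> glob l ` exps r"
        using i kij by (intro image_eqI[of _ _ "(i, j)"]) (auto simp: glob_def)
      then have kl: "k \<noteq> l" using p pe by auto
      have "(nx l, i, 0) \<in> glob l ` exps r"
        using i kij by (intro image_eqI[of _ _ "(0, i)"]) (auto simp: glob_def)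
      then have "k = nx l \<Longrightarrow> j \<ge> 1" using p pe by (cases j) auto
      then have "basis_fun r p (pt l s t) = 0"
        unfolding pe basis_fun_pt[OF kij(1) l st]
        using i kl nx(2)[OF nx(1)[OF l]] nx(3)[OF l] by auto
      then show "a p * basis_fun r p (pt l s t) = 0" by simp
    qed
  qed (use finite_idx glob_in_idx[OF l] in auto)
  also have "\<dots> = (\<Sum>p\<in>exps r. a (glob l p) * basis_fun r (glob l p) (pt l s t))"
    by (simp add: sum.reindex[OF inj_glob[OF l]])
  also have "\<dots> = (\<Sum>(i, j)\<in>exps r. a (glob l (i, j)) * (1 - s - t) ^ (r - i - j) * s ^ i * t ^ j)"
  proof (rule sum.cong[OF refl], clarify)
    fix i j :: nat
    have "basis_fun r (glob l (i, j)) (pt l s t) = (1 - s - t) ^ (r - i - j) * s ^ i * t ^ j"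
      using nx(1,2)[OF l] k0 l st by (cases i; cases j) (auto simp: glob_def basis_fun_pt)
    then show "a (glob l (i, j)) * basis_fun r (glob l (i, j)) (pt l s t)
      = a (glob l (i, j)) * (1 - s - t) ^ (r - i - j) * s ^ i * t ^ j" by simp
  qed
  finally show ?thesis .
qed

lemma idx_cases:
  assumes "(k, i, j) \<in> idx r"
  shows "k \<in> K" "(i, j) \<in> exps r" "(k, i, j) = glob k (i, j)"
  using assms k0 by (auto simp: idx_def glob_def)

text \<open>It suffices to look at the triangle named by the index: \<open>glob k (i, j)\<close> is
  the index itself, so its coefficient is one of the Bernstein coefficients on triangle
  \<open>k\<close>.\<close>

lemma basis_fun_indep:
  assumes zero: "\<And>x. (\<Sum>p\<in>idx r. a p * basis_fun r p x) = 0" and p: "p \<in> idx r"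
  shows "a p = 0"
proof -
  obtain k i j where pe: "p = (k, i, j)" by (cases p)
  note k = idx_cases[OF p[unfolded pe]]
  have "a (glob k (i, j)) = 0"
    by (rule form_indep[where k = r and c = "\<lambda>i j. a (glob k (i, j))"])
      (use k zero sum_basis_fun_pt[OF k(1), of _ _ a r] in auto)
  then show ?thesis using k(3) pe by simp
qed

lemma fan_space_bernstein:
  assumes q: "q \<in> fan_space r" and l: "l \<in> K"
  obtains c where "\<And>s t. 0 \<le> s \<Longrightarrow> 0 \<le> t \<Longrightarrow> s + t \<le> 1 \<Longrightarrow>
    q (pt l s t) = (\<Sum>(i, j)\<in>exps r. c i j * (1 - s - t) ^ (r - i - j) * s ^ i * t ^ j)"
proof -
  obtain g where g: "form r g" "restrict0 (tri l) q = restrict0 (tri l) (\<lambda>x. g 1 (x $ 1) (x $ 2))"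
    using q l by (auto simp: fan_space_def polys_on_eq_forms)
  let ?L = "\<lambda>i m s t. ctr $ i * m + v l $ i * s + v (nx l) $ i * t"
  have "form r (\<lambda>m s t. g (1 * m + 1 * s + 1 * t) (?L 1 m s t) (?L 2 m s t))"
    by (rule form_subst[OF g(1) form_linear form_linear form_linear])
  then obtain c where c: "(\<lambda>m s t. g (1 * m + 1 * s + 1 * t) (?L 1 m s t) (?L 2 m s t))
      = (\<lambda>m s t. \<Sum>(i, j)\<in>exps r. c i j * m ^ (r - i - j) * s ^ i * t ^ j)"
    unfolding form_iff by blast
  show ?thesis
  proof (rule that[of c])
    fix s t :: real assume st: "0 \<le> s" "0 \<le> t" "s + t \<le> 1"
    have "q (pt l s t) = g 1 (pt l s t $ 1) (pt l s t $ 2)"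
      using fun_cong[OF g(2), of "pt l s t"] st tri_eq[of l] by (auto simp: restrict0_def split: if_splits)
    also have "\<dots> = g (1 * (1 - s - t) + 1 * s + 1 * t) (?L 1 (1 - s - t) s t) (?L 2 (1 - s - t) s t)"
      by (simp add: pt_def algebra_simps)
    also have "\<dots> = (\<Sum>(i, j)\<in>exps r. c i j * (1 - s - t) ^ (r - i - j) * s ^ i * t ^ j)"
      using fun_cong[OF fun_cong[OF fun_cong[OF c, of "1 - s - t"], of s], of t] by simp
    finally show "q (pt l s t) = \<dots>" .
  qed
qed


lemma fan_space_span:
  assumes q: "q \<in> fan_space r"
  shows "\<exists>a. \<forall>x. q x = (\<Sum>p\<in>idx r. a p * basis_fun r p x)"
proof -
  define P where "P l c \<longleftrightarrow> (\<forall>s t. 0 \<le> s \<longrightarrow> 0 \<le> t \<longrightarrow> s + t \<le> 1 \<longrightarrow>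
    q (pt l s t) = (\<Sum>(i, j)\<in>exps r. c i j * (1 - s - t) ^ (r - i - j) * s ^ i * t ^ j))" for l c
  have "\<exists>c. P l c" if l: "l \<in> K" for l
    by (rule fan_space_bernstein[OF q l]) (auto simp: P_def)
  then obtain c where Pc: "\<And>l. l \<in> K \<Longrightarrow> P l (c l)" by metis
  have c: "q (pt l s t) = (\<Sum>(i, j)\<in>exps r. c l i j * (1 - s - t) ^ (r - i - j) * s ^ i * t ^ j)"
    if "l \<in> K" "0 \<le> s" "0 \<le> t" "s + t \<le> 1" for l s t
    using Pc[OF that(1)] that(2-4) unfolding P_def by simp
  \<comment> \<open>The spoke from \<open>ctr\<close> to \<open>v (nx l)\<close> is the side
    \<open>s = 0\<close> of triangle \<open>l\<close> and the side \<open>t = 0\<close> of triangle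
    \<open>nx l\<close>. Both local forms give the values of \<open>q\<close> on it, so their
    coefficients agree.\<close>
  have spoke: "c l 0 j = c (nx l) j 0" if l: "l \<in> K" and j: "j \<le> r" for l j
  proof -
    have "c l 0 j - c (nx l) j 0 = 0"
    proof (rule bernstein_indep[where k = r and c = "\<lambda>j. c l 0 j - c (nx l) j 0"])
      fix t :: real assume t: "0 \<le> t" "t \<le> 1"
      have "pt l 0 t = pt (nx l) t 0" by (simp add: pt_def)
      then have "(\<Sum>j\<le>r. c l 0 j * (1 - t) ^ (r - j) * t ^ j)
        = (\<Sum>j\<le>r. c (nx l) j 0 * (1 - t) ^ (r - j) * t ^ j)"
        using c[OF l, of 0 t] c[OF nx(1)[OF l], of t 0] t
          sum_exps_s0[of "c l" "1 - t" r t] sum_exps_t0[of "c (nx l)" "1 - t" r t]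
        by simp
      then show "(\<Sum>j\<le>r. (c l 0 j - c (nx l) j 0) * (1 - t) ^ (r - j) * t ^ j) = 0"
        by (simp add: left_diff_distrib sum_subtractf)
    qed (rule j)
    then show ?thesis by simp
  qed
  \<comment> \<open>At the centre only the coefficient with both exponents 0 survives, and its value
    is \<open>q ctr\<close> in every triangle.\<close>
  have centre: "c l 0 0 = c k0 0 0" if l: "l \<in> K" for l
  proof -
    have "c l 0 0 = q ctr" if l: "l \<in> K" for l
    proof -
      have "(\<Sum>j\<le>r. c l 0 j * 1 ^ (r - j) * 0 ^ j) = (\<Sum>j\<in>{0}. c l 0 j * 1 ^ (r - j) * 0 ^ j)"
        by (rule sum.mono_neutral_right) auto
      then show ?thesis using c[OF l, of 0 0] sum_exps_s0[of "c l" 1 r 0] by (simp add: pt_def)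
    qed
    then show ?thesis using l k0 by simp
  qed
  \<comment> \<open>Each index takes its coefficient from the triangle it names; that the other
    triangles agree is exactly \<open>spoke\<close> and \<open>centre\<close>.\<close>
  define a where "a = (\<lambda>(k, i, j). c k i j)"
  have a: "a (glob l (i, j)) = c l i j" if "l \<in> K" "(i, j) \<in> exps r" for l i j
    using that spoke[of l j] centre[of l] by (cases i; cases j) (auto simp: a_def glob_def)
  have "q x = (\<Sum>p\<in>idx r. a p * basis_fun r p x)" for x
  proof (cases "x \<in> T")
    case True
    then obtain l s t where l: "l \<in> K" and st: "0 \<le> s" "0 \<le> t" "s + t \<le> 1" and x: "x = pt l s t"
      by (rule T_cases)
    show ?thesis unfolding x sum_basis_fun_pt[OF l st] c[OF l st]
      by (rule sum.cong) (auto simp: a[OF l])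
  next
    case False
    then show ?thesis using q by (simp add: fan_space_def basis_fun_outside)
  qed
  then show ?thesis by blast
qed

lemma dim_fan_space_idx: "fun_space.dim (fan_space r) = card (idx r)"
proof (rule fun_space_dim_eq_card[where f = "basis_fun r"])
  show "a p = 0" if "\<And>x. (\<Sum>p\<in>idx r. a p * basis_fun r p x) = 0" "p \<in> idx r" for a p
    using that by (rule basis_fun_indep)
qed (simp_all add: finite_idx basis_fun_mem fan_space_span)

section \<open>The subspace with zero boundary values and zero mean\<close>

definition idx0 :: "nat \<Rightarrow> ('i \<times> nat \<times> nat) set" where
  "idx0 r = {(k, i, j). k \<in> K \<and> 1 \<le> i \<and> i + j < r}"

lemma frontier_cases:
  assumes "x \<in> frontier T"
  obtains l t where "l \<in> K" "0 \<le> t" "t \<le> 1" "x = pt l (1 - t) t"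
  using assms unfolding frontier_T closed_segment_def
  by (auto simp: pt_def algebra_simps intro: that)

lemma pt_frontier: "l \<in> K \<Longrightarrow> 0 \<le> t \<Longrightarrow> t \<le> 1 \<Longrightarrow> pt l (1 - t) t \<in> frontier T"
  unfolding frontier_T closed_segment_def
  by (rule UN_I[of l], assumption) (auto simp: pt_def algebra_simps intro!: exI[of _ t])

lemma lam0_frontier: "x \<in> frontier T \<Longrightarrow> lam0 x = 0"
  by (elim frontier_cases) (simp add: lam0_pt)

lemma basis_fun_frontier:
  assumes "(k, i, j) \<in> idx r" "i + j < r" "x \<in> frontier T"
  shows "basis_fun r (k, i, j) x = 0"
  using assms by (simp add: basis_fun_def restrict0_def lam0_frontier)

text \<open>On the outer side of triangle \<open>k\<close> the function \<open>lam0\<close> is 0, so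
  only exponents with \<open>i + j = r\<close> contribute, and these are the Bernstein monomials of
  the side.\<close>

lemma boundary_coeff_zero:
  assumes q: "\<And>x. x \<in> frontier T \<Longrightarrow> (\<Sum>p\<in>idx r. a p * basis_fun r p x) = 0"
    and p: "(k, i, j) \<in> idx r" "i + j = r"
  shows "a (k, i, j) = 0"
proof -
  note k = idx_cases[OF p(1)]
  have "a (glob k (r - j, j)) = 0"
  proof (rule bernstein_indep[where k = r and c = "\<lambda>j. a (glob k (r - j, j))"])
    fix t :: real assume t: "0 \<le> t" "t \<le> 1"
    have "(\<Sum>(i, j)\<in>exps r. a (glob k (i, j)) * 0 ^ (r - i - j) * (1 - t) ^ i * t ^ j) = 0"
      using q[OF pt_frontier[OF k(1) t]] sum_basis_fun_pt[OF k(1), of "1 - t" t a r] t by simp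
    then show "(\<Sum>j\<le>r. a (glob k (r - j, j)) * (1 - t) ^ (r - j) * t ^ j) = 0"
      using sum_exps_m0[of "\<lambda>i j. a (glob k (i, j))" r "1 - t" t] by simp
  qed (use p in auto)
  then show ?thesis using k p by auto
qed

lemma integrable_fan_space: "q \<in> fan_space r \<Longrightarrow> q integrable_on T"
  by (intro continuous_on_compact_integrable compact_T) (simp add: fan_space_def)

lemma fan_space_diff_cmult:
  assumes "f \<in> fan_space r" "g \<in> fan_space r"
  shows "(\<lambda>x. f x - c * g x) \<in> fan_space r"
proof -
  have "restrict0 (tri l) (\<lambda>x. f x - c * g x) \<in> polys_on (int r) (tri l)" if l: "l \<in> K" for l
  proof -
    obtain u where u: "form r u" "restrict0 (tri l) f = restrict0 (tri l) (\<lambda>x. u 1 (x $ 1) (x $ 2))"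
      using assms(1) l by (auto simp: fan_space_def polys_on_eq_forms)
    obtain w where w: "form r w" "restrict0 (tri l) g = restrict0 (tri l) (\<lambda>x. w 1 (x $ 1) (x $ 2))"
      using assms(2) l by (auto simp: fan_space_def polys_on_eq_forms)
    have "form r (\<lambda>m s t. u m s t + (- c) * w m s t)"
      by (intro form_add form_cmult u w)
    moreover have "restrict0 (tri l) (\<lambda>x. f x - c * g x)
        = restrict0 (tri l) (\<lambda>x. u 1 (x $ 1) (x $ 2) + (- c) * w 1 (x $ 1) (x $ 2))"
    proof
      fix x
      show "restrict0 (tri l) (\<lambda>x. f x - c * g x) x
        = restrict0 (tri l) (\<lambda>x. u 1 (x $ 1) (x $ 2) + (- c) * w 1 (x $ 1) (x $ 2)) x"
        using fun_cong[OF u(2), of x] fun_cong[OF w(2), of x]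
          by (cases "x \<in> tri l") (simp_all add: restrict0_def)
    qed
    ultimately show ?thesis unfolding polys_on_eq_forms
      by (intro CollectI exI[of _ "\<lambda>m s t. u m s t + (- c) * w m s t"] conjI)
  qed
  then show ?thesis using assms by (auto simp: fan_space_def intro!: continuous_intros)
qed

lemma dim_fan_space0_idx0:
  assumes "r \<ge> 1"
  shows "fun_space.dim (fan_space0 r) = card (idx0 r)"
proof -
  let ?o = "(k0, 0, 0)"
  define B where "B = basis_fun r"
  define w where "w p = integral T (B p) / integral T (B ?o)" for p
  define f where "f p = (\<lambda>x. B p x - w p * B ?o x)" for p
  have o: "?o \<in> idx r" by (simp add: idx_def)
  have I0: "idx0 r \<subseteq> idx r" "?o \<notin> idx0 r" by (auto simp: idx0_def idx_def)
  have mem: "B p \<in> fan_space r" if "p \<in> idx r" for p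
    using basis_fun_mem[OF that] by (simp add: B_def)
  have pos: "integral T (B ?o) \<noteq> 0"
  proof
    assume int0: "integral T (B ?o) = 0"
    have "B ?o ctr = 0"
    proof (rule integral_eq_0_imp_eq_0[OF compact_T convex_T _ _ _ int0])
      show "interior T \<noteq> {}" using ctr by blast
      show "continuous_on T (B ?o)" using mem[OF o] by (simp add: fan_space_def)
      show "0 \<le> B ?o x" if "x \<in> T" for x
        using lam0_nonneg[OF that] by (simp add: B_def basis_fun_def restrict0_def)
      show "ctr \<in> T" using ctr interior_subset by blast
    qed
    moreover have "B ?o (pt k0 0 0) = 1"
      using k0 by (simp add: B_def basis_fun_pt)
    ultimately show False by (simp add: pt_def)
  qed
  have frontier0: "B p x = 0" if "p \<in> insert ?o (idx0 r)" "x \<in> frontier T" for p x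
  proof -
    obtain k i j where pe: "p = (k, i, j)" by (cases p)
    have "(k, i, j) \<in> idx r" using that(1) o I0(1) unfolding pe by blast
    \<comment> \<open>For the central index this is \<open>0 < r\<close>: its function is a positive
      power of \<open>lam0\<close>.\<close>
    moreover have "i + j < r" using that(1) assms by (auto simp: pe idx0_def)
    ultimately show ?thesis unfolding B_def pe using that(2) by (rule basis_fun_frontier)
  qed
  have int: "integral T (B p) = w p * integral T (B ?o)" for p
    using pos by (simp add: w_def)
  have integrable: "B p integrable_on T" if "p \<in> idx r" for p
    using integrable_fan_space mem that by blast
  have fin: "finite (idx0 r)" by (rule finite_subset[OF I0(1) finite_idx])
  show ?thesis
  proof (rule fun_space_dim_eq_card[where f = f])
    fix p assume p: "p \<in> idx0 r"
    then have p': "p \<in> idx r" using I0 by blast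
    have "integral T (f p) = integral T (B p) - w p * integral T (B ?o)"
      unfolding f_def using integrable[OF p'] integrable[OF o]
      by (subst integral_diff) (auto intro: integrable_on_mult_right)
    then show "f p \<in> fan_space0 r"
      using fan_space_diff_cmult[OF mem[OF p'] mem[OF o], of "w p"] int[of p] p
      unfolding f_def by (simp add: fan_space0_def frontier0)
  next
    fix a p
    assume zero: "\<And>x. (\<Sum>p\<in>idx0 r. a p * f p x) = 0" and p: "p \<in> idx0 r"
    \<comment> \<open>A relation among the corrected functions is rewritten in the full basis; the
      coefficient of the central function collects all the corrections.\<close>
    define b where "b q = (if q = ?o then - (\<Sum>p\<in>idx0 r. a p * w p) else if q \<in> idx0 r then a q else 0)" for q
    have "(\<Sum>p\<in>idx r. b p * B p x) = 0" for x
    proof -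
      have "(\<Sum>p\<in>idx r. b p * B p x) = (\<Sum>p\<in>insert ?o (idx0 r). b p * B p x)"
        using I0 o finite_idx by (intro sum.mono_neutral_right) (auto simp: b_def)
      also have "\<dots> = b ?o * B ?o x + (\<Sum>p\<in>idx0 r. b p * B p x)"
        using I0 fin by simp
      also have "(\<Sum>p\<in>idx0 r. b p * B p x) = (\<Sum>p\<in>idx0 r. a p * B p x)"
        using I0 by (intro sum.cong) (auto simp: b_def)
      also have "b ?o * B ?o x + \<dots> = (\<Sum>p\<in>idx0 r. a p * f p x)"
        by (simp add: b_def f_def right_diff_distrib sum_subtractf sum_distrib_left sum_distrib_right mult_ac)
      finally show ?thesis using zero by simp
    qed
    then have "b p = 0" using basis_fun_indep[where r = r and a = b and p = p] p I0 by (auto simp: B_def)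
    then show "a p = 0" using p I0 by (auto simp: b_def split: if_splits)
  next
    fix q assume q: "q \<in> fan_space0 r"
    then obtain a where a: "\<And>x. q x = (\<Sum>p\<in>idx r. a p * B p x)"
      using fan_space_span[of q r] unfolding fan_space0_def B_def by blast
    \<comment> \<open>What lies outside \<open>insert ?o (idx0 r)\<close> has
      \<open>i + j = r\<close>, so the boundary values determine these coefficients.\<close>
    have a0: "a p = 0" if p: "p \<in> idx r - insert ?o (idx0 r)" for p
    proof -
      obtain k i j where pe: "p = (k, i, j)" by (cases p)
      have "i + j = r" using p by (auto simp: pe idx_def idx0_def)
      then show ?thesis
        using boundary_coeff_zero[where r = r and a = a and k = k and i = i and j = j] q a p unfolding pe B_def fan_space0_def by auto
    qed
    have q2: "q x = a ?o * B ?o x + (\<Sum>p\<in>idx0 r. a p * B p x)" for x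
    proof -
      have "q x = (\<Sum>p\<in>insert ?o (idx0 r). a p * B p x)"
        unfolding a using I0 o finite_idx a0 by (intro sum.mono_neutral_right) auto
      then show ?thesis using I0 fin by simp
    qed
    \<comment> \<open>Integrating the expansion makes zero mean a linear equation for the central
      coefficient, whose solution is the one that regroups \<open>q\<close> into the corrected
      functions.\<close>
    have "integral T q = a ?o * integral T (B ?o) + (\<Sum>p\<in>idx0 r. a p * integral T (B p))"
    proof -
      have "integral T q = integral T (\<lambda>x. a ?o * B ?o x + (\<Sum>p\<in>idx0 r. a p * B p x))"
        using q2 by (intro integral_cong) simp
      also have "\<dots> = integral T (\<lambda>x. a ?o * B ?o x) + integral T (\<lambda>x. \<Sum>p\<in>idx0 r. a p * B p x)"
        using integrable I0 o fin by (intro integral_add integrable_sum integrable_on_mult_right) auto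
      also have "integral T (\<lambda>x. \<Sum>p\<in>idx0 r. a p * B p x) = (\<Sum>p\<in>idx0 r. integral T (\<lambda>x. a p * B p x))"
        using integrable I0 fin by (intro integral_sum integrable_on_mult_right) auto
      finally show ?thesis by simp
    qed
    also have "(\<Sum>p\<in>idx0 r. a p * integral T (B p)) = (\<Sum>p\<in>idx0 r. a p * w p * integral T (B ?o))"
      by (intro sum.cong refl) (subst int, rule mult.assoc[symmetric])
    also have "a ?o * integral T (B ?o) + \<dots> = (a ?o + (\<Sum>p\<in>idx0 r. a p * w p)) * integral T (B ?o)"
      by (simp add: distrib_right sum_distrib_right)
    finally have "a ?o = - (\<Sum>p\<in>idx0 r. a p * w p)"
      using q pos by (auto simp: fan_space0_def)
    then have "q x = (\<Sum>p\<in>idx0 r. a p * f p x)" for x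
      unfolding q2 by (simp add: f_def right_diff_distrib sum_subtractf sum_distrib_left sum_distrib_right mult_ac)
    then show "\<exists>a. \<forall>x. q x = (\<Sum>p\<in>idx0 r. a p * f p x)" by blast
  qed (rule fin)
qed

section \<open>Counting the basis, and unisolvence on a fan\<close>

lemma card_idx: "2 * card (idx r) = card K * (r * (r + 1)) + 2"
proof -
  have "idx r = insert (k0, 0, 0) (K \<times> {(i, j). 1 \<le> i \<and> i + j \<le> r})"
    by (auto simp: idx_def)
  moreover have "finite {(i, j). 1 \<le> i \<and> i + j \<le> r}" by (rule finite_subset[of _ "exps r"]) auto
  ultimately show ?thesis
    using finite_K card_pos_exps[of r] by (simp add: card_cartesian_product algebra_simps)
qed

lemma card_idx0: "2 * card (idx0 r) = card K * ((r - 1) * r)"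
proof (cases r)
  case (Suc n)
  have "idx0 r = K \<times> {(i, j). 1 \<le> i \<and> i + j \<le> n}" by (auto simp: idx0_def Suc)
  then show ?thesis using card_pos_exps[of n] by (simp add: card_cartesian_product Suc)
next
  case 0
  have "idx0 0 = {}" by (auto simp: idx0_def)
  then show ?thesis by (simp add: 0)
qed

lemma fan_space_unisolvent:
  assumes q: "q \<in> fan_space r" and r: "r \<ge> 1"
    and vertices: "\<And>k. k \<in> K \<Longrightarrow> q (v k) = 0"
    and edges: "\<And>k p. k \<in> K \<Longrightarrow> p \<in> polys_on (int r - 2) (closed_segment (v k) (v (nx k))) \<Longrightarrow>
      edge_integral (v k) (v (nx k)) (\<lambda>x. q x * p x) = 0"
    and mean: "integral T q = 0"
    and orth: "\<And>p. p \<in> fan_space0 r \<Longrightarrow> integral T (\<lambda>x. q x * p x) = 0"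
  shows "q x = 0"
proof -
  have seg: "q x = 0" if l: "l \<in> K" and x: "x \<in> closed_segment (v l) (v (nx l))" for l x
  proof -
    obtain c where c: "\<And>s t. 0 \<le> s \<Longrightarrow> 0 \<le> t \<Longrightarrow> s + t \<le> 1 \<Longrightarrow>
      q (pt l s t) = (\<Sum>(i, j)\<in>exps r. c i j * (1 - s - t) ^ (r - i - j) * s ^ i * t ^ j)"
      using fan_space_bernstein[OF q l] by blast
    show ?thesis
    \<comment> \<open>On the outer side the first barycentric coordinate is 0, which leaves the
      coefficients with \<open>i = r - j\<close>.\<close>
    proof (rule zero_on_segment[OF _ r, where c = "\<lambda>j. c (r - j) j"])
      show "v l \<noteq> v (nx l)"
        using edges_indep(1)[OF l, of 1 "-1"] by auto
      fix t :: real assume t: "t \<in> {0..1}"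
      have "linepath (v l) (v (nx l)) t = pt l (1 - t) t"
        by (simp add: linepath_def pt_def algebra_simps)
      then show "q (linepath (v l) (v (nx l)) t) = (\<Sum>j\<le>r. c (r - j) j * (1 - t) ^ (r - j) * t ^ j)"
        using c[of "1 - t" t] t sum_exps_m0[of c r "1 - t" t] by simp
    qed (use vertices edges l nx x in auto)
  qed
  have "q \<in> fan_space0 r"
    using q mean seg by (auto simp: fan_space0_def frontier_T)
  then have sq: "integral T (\<lambda>x. q x * q x) = 0" by (rule orth)
  show ?thesis
  proof (cases "x \<in> T")
    case True
    have "q x * q x = 0"
    proof (rule integral_eq_0_imp_eq_0[OF compact_T convex_T _ _ _ sq True])
      show "interior T \<noteq> {}" using ctr by blast
      show "continuous_on T (\<lambda>x. q x * q x)"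
        using q by (auto simp: fan_space_def intro!: continuous_intros)
    qed simp
    then show ?thesis by simp
  qed (use q in \<open>simp add: fan_space_def\<close>)
qed

end

section \<open>Triangles split from an interior point\<close>

text \<open>Cramer's rule, where \<open>D\<close> is twice the area of the triangle. The functions
  are affine on the whole plane, and their values are identified for coefficients of any
  sign.\<close>

lemma barycentric_coordinates:
  fixes p q r :: "real^2"
  assumes "(q - p) $ 1 * (r - p) $ 2 - (q - p) $ 2 * (r - p) $ 1 > 0"
  obtains b\<^sub>1 b\<^sub>2 b\<^sub>3 :: "real^2 \<Rightarrow> real"
  where "continuous_on UNIV b\<^sub>1" "continuous_on UNIV b\<^sub>2" "continuous_on UNIV b\<^sub>3"
    "\<And>c\<^sub>1 c\<^sub>2 c\<^sub>3. c\<^sub>1 + c\<^sub>2 + c\<^sub>3 = 1 \<Longrightarrow> b\<^sub>1 (c\<^sub>1 *\<^sub>R p + c\<^sub>2 *\<^sub>R q + c\<^sub>3 *\<^sub>R r) = c\<^sub>1"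
    "\<And>c\<^sub>1 c\<^sub>2 c\<^sub>3. c\<^sub>1 + c\<^sub>2 + c\<^sub>3 = 1 \<Longrightarrow> b\<^sub>2 (c\<^sub>1 *\<^sub>R p + c\<^sub>2 *\<^sub>R q + c\<^sub>3 *\<^sub>R r) = c\<^sub>2"
    "\<And>c\<^sub>1 c\<^sub>2 c\<^sub>3. c\<^sub>1 + c\<^sub>2 + c\<^sub>3 = 1 \<Longrightarrow> b\<^sub>3 (c\<^sub>1 *\<^sub>R p + c\<^sub>2 *\<^sub>R q + c\<^sub>3 *\<^sub>R r) = c\<^sub>3"
proof -
  define a where "a = q - p"
  define b where "b = r - p"
  define D where "D = a $ 1 * b $ 2 - a $ 2 * b $ 1"
  have D: "D > 0" using assms by (simp add: D_def a_def b_def)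
  define f where "f x = ((x - p) $ 1 * b $ 2 - (x - p) $ 2 * b $ 1) / D" for x
  define g where "g x = (a $ 1 * (x - p) $ 2 - a $ 2 * (x - p) $ 1) / D" for x
  have x: "c\<^sub>1 *\<^sub>R p + c\<^sub>2 *\<^sub>R q + c\<^sub>3 *\<^sub>R r - p = c\<^sub>2 *\<^sub>R a + c\<^sub>3 *\<^sub>R b"
    if "c\<^sub>1 + c\<^sub>2 + c\<^sub>3 = 1" for c\<^sub>1 c\<^sub>2 c\<^sub>3
  proof -
    have c1: "c\<^sub>1 = 1 - c\<^sub>2 - c\<^sub>3" using that by simp
    show ?thesis unfolding c1 by (simp add: a_def b_def algebra_simps)
  qed
  have f: "f (c\<^sub>1 *\<^sub>R p + c\<^sub>2 *\<^sub>R q + c\<^sub>3 *\<^sub>R r) = c\<^sub>2" if "c\<^sub>1 + c\<^sub>2 + c\<^sub>3 = 1" for c\<^sub>1 c\<^sub>2 c\<^sub>3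
  proof -
    have "f (c\<^sub>1 *\<^sub>R p + c\<^sub>2 *\<^sub>R q + c\<^sub>3 *\<^sub>R r) = c\<^sub>2 * D / D"
      unfolding f_def x[OF that] by (simp add: D_def algebra_simps)
    then show ?thesis using D by simp
  qed
  have g: "g (c\<^sub>1 *\<^sub>R p + c\<^sub>2 *\<^sub>R q + c\<^sub>3 *\<^sub>R r) = c\<^sub>3" if "c\<^sub>1 + c\<^sub>2 + c\<^sub>3 = 1" for c\<^sub>1 c\<^sub>2 c\<^sub>3
  proof -
    have "g (c\<^sub>1 *\<^sub>R p + c\<^sub>2 *\<^sub>R q + c\<^sub>3 *\<^sub>R r) = c\<^sub>3 * D / D"
      unfolding g_def x[OF that] by (simp add: D_def algebra_simps)
    then show ?thesis using D by simp
  qed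
  have cont: "continuous_on UNIV f" "continuous_on UNIV g"
    unfolding f_def g_def using D by (auto intro!: continuous_intros)
  show ?thesis
  proof (rule that[of "\<lambda>x. 1 - f x - g x" f g])
    show "1 - f (c\<^sub>1 *\<^sub>R p + c\<^sub>2 *\<^sub>R q + c\<^sub>3 *\<^sub>R r) - g (c\<^sub>1 *\<^sub>R p + c\<^sub>2 *\<^sub>R q + c\<^sub>3 *\<^sub>R r) = c\<^sub>1"
      if "c\<^sub>1 + c\<^sub>2 + c\<^sub>3 = 1" for c\<^sub>1 c\<^sub>2 c\<^sub>3
      using f[OF that] g[OF that] that by simp
  qed (use cont f g in \<open>auto intro!: continuous_intros\<close>)
qed

lemma not_collinear_if_orientation_pos:
  fixes p q r :: "real^2"
  assumes "(q - p) $ 1 * (r - p) $ 2 - (q - p) $ 2 * (r - p) $ 1 > 0"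
  shows "\<not> collinear {p, q, r}"
proof
  assume "collinear {p, q, r}"
  then obtain u where u: "\<And>x y. x \<in> {p, q, r} \<Longrightarrow> y \<in> {p, q, r} \<Longrightarrow> \<exists>c. x - y = c *\<^sub>R u"
    unfolding collinear_def by blast
  obtain c d where "q - p = c *\<^sub>R u" "r - p = d *\<^sub>R u" using u[of q p] u[of r p] by auto
  with assms show False by simp
qed

text \<open>The segment from \<open>c\<close> to \<open>w\<close> consists of the points whose
  weights at \<open>p\<close> and \<open>q\<close> are in the ratio 1 - u to u. On the
  \<open>p\<close> side of it, \<open>q\<close> is eliminated in favour of \<open>w\<close>, which
  gives \<open>w\<close> the weight \<open>t / u\<close>; on the other side \<open>p\<close> is
  eliminated.\<close>

lemma convex_hull_split_edge:
  fixes c p q :: "'a::euclidean_space"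
  assumes "w \<in> open_segment p q"
  shows "convex hull {c, p, q} = convex hull {c, p, w} \<union> convex hull {c, w, q}"
proof
  obtain u where u: "0 < u" "u < 1" and w: "w = (1 - u) *\<^sub>R p + u *\<^sub>R q"
    using assms by (auto simp: in_segment)
  show "convex hull {c, p, q} \<subseteq> convex hull {c, p, w} \<union> convex hull {c, w, q}"
  proof
    fix x assume "x \<in> convex hull {c, p, q}"
    then obtain m s t where mst: "0 \<le> m" "0 \<le> s" "0 \<le> t" "m + s + t = 1"
      and x: "x = m *\<^sub>R c + s *\<^sub>R p + t *\<^sub>R q"
      unfolding convex_hull_3 by blast
    show "x \<in> convex hull {c, p, w} \<union> convex hull {c, w, q}"
    proof (cases "t * (1 - u) \<le> s * u")
      case True
      define k where "k = t / u"
      have t: "t = k * u" using u by (simp add: k_def)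
      have "k * (1 - u) * u \<le> s * u" using True t by (simp add: mult_ac)
      then have "0 \<le> s - (1 - u) * k" using u by (simp add: mult_ac)
      moreover have "0 \<le> k" using mst u by (simp add: k_def)
      moreover have "m + (s - (1 - u) * k) + k = 1" using mst t by (simp add: algebra_simps)
      moreover have "x = m *\<^sub>R c + (s - (1 - u) * k) *\<^sub>R p + k *\<^sub>R w"
        by (simp add: x w t algebra_simps)
      ultimately show ?thesis using mst unfolding convex_hull_3 by blast
    next
      case False
      define k where "k = s / (1 - u)"
      have s: "s = k * (1 - u)" using u by (simp add: k_def)
      have "k * u * (1 - u) \<le> t * (1 - u)" using False s by (simp add: mult_ac)
      then have "0 \<le> t - u * k" using u by (simp add: mult_ac)
      moreover have "0 \<le> k" using mst u by (simp add: k_def)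
      moreover have "m + k + (t - u * k) = 1" using mst s by (simp add: algebra_simps)
      moreover have "x = m *\<^sub>R c + k *\<^sub>R w + (t - u * k) *\<^sub>R q"
        by (simp add: x w s algebra_simps)
      ultimately show ?thesis using mst unfolding convex_hull_3 by blast
    qed
  qed
  have "w \<in> closed_segment p q" using assms open_closed_segment by blast
  also have "\<dots> \<subseteq> convex hull {c, p, q}"
    unfolding segment_convex_hull by (rule hull_mono) auto
  finally have "w \<in> convex hull {c, p, q}" .
  then show "convex hull {c, p, w} \<union> convex hull {c, w, q} \<subseteq> convex hull {c, p, q}"
    by (intro Un_least hull_minimal convex_convex_hull) (auto intro: hull_inc)
qed

text \<open>The vertex \<open>r\<close> is eliminated in favour of the centre, whose weight must
  then be \<open>c\<^sub>3 / a\<^sub>3\<close>. The weights left for \<open>p\<close> and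
  \<open>q\<close> are nonnegative because this ratio is the smallest of the three.\<close>

lemma convex_hull_3_centre_aux:
  fixes p q r :: "'a::real_vector"
  assumes a: "0 < a\<^sub>3" "a\<^sub>1 + a\<^sub>2 + a\<^sub>3 = 1" and c: "0 \<le> c\<^sub>3" "c\<^sub>1 + c\<^sub>2 + c\<^sub>3 = 1"
    and min: "c\<^sub>3 * a\<^sub>1 \<le> c\<^sub>1 * a\<^sub>3" "c\<^sub>3 * a\<^sub>2 \<le> c\<^sub>2 * a\<^sub>3"
  shows "c\<^sub>1 *\<^sub>R p + c\<^sub>2 *\<^sub>R q + c\<^sub>3 *\<^sub>R r
    \<in> convex hull {a\<^sub>1 *\<^sub>R p + a\<^sub>2 *\<^sub>R q + a\<^sub>3 *\<^sub>R r, p, q}"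
proof -
  define m where "m = c\<^sub>3 / a\<^sub>3"
  have c3: "c\<^sub>3 = m * a\<^sub>3" using a by (simp add: m_def)
  have "0 \<le> m" using a c by (simp add: m_def)
  moreover have "0 \<le> c\<^sub>1 - m * a\<^sub>1" "0 \<le> c\<^sub>2 - m * a\<^sub>2"
    using min a(1) by (simp_all add: c3 mult_ac)
  moreover have "m + (c\<^sub>1 - m * a\<^sub>1) + (c\<^sub>2 - m * a\<^sub>2) = 1"
  proof -
    have a3: "a\<^sub>3 = 1 - a\<^sub>1 - a\<^sub>2" using a(2) by simp
    have "m + (c\<^sub>1 - m * a\<^sub>1) + (c\<^sub>2 - m * a\<^sub>2) = c\<^sub>1 + c\<^sub>2 + m * a\<^sub>3"
      unfolding a3 by (simp add: algebra_simps)
    then show ?thesis using c(2) c3 by simp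
  qed
  moreover have "c\<^sub>1 *\<^sub>R p + c\<^sub>2 *\<^sub>R q + c\<^sub>3 *\<^sub>R r
    = m *\<^sub>R (a\<^sub>1 *\<^sub>R p + a\<^sub>2 *\<^sub>R q + a\<^sub>3 *\<^sub>R r) + (c\<^sub>1 - m * a\<^sub>1) *\<^sub>R p + (c\<^sub>2 - m * a\<^sub>2) *\<^sub>R q"
    by (simp add: c3 algebra_simps)
  ultimately show ?thesis unfolding convex_hull_3 by (metis (mono_tags, lifting) mem_Collect_eq)
qed

text \<open>A point lies in the subtriangle that omits the vertex with the smallest ratio of its
  barycentric coordinate to that of the centre; cyclic relabelling reduces all cases to the previous
  lemma.\<close>

lemma convex_hull_3_centre:
  fixes p q r :: "'a::real_vector"
  assumes a: "0 < a\<^sub>1" "0 < a\<^sub>2" "0 < a\<^sub>3" "a\<^sub>1 + a\<^sub>2 + a\<^sub>3 = 1"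
    and c: "c = a\<^sub>1 *\<^sub>R p + a\<^sub>2 *\<^sub>R q + a\<^sub>3 *\<^sub>R r"
  shows "convex hull {p, q, r}
    = convex hull {c, q, r} \<union> convex hull {c, r, p} \<union> convex hull {c, p, q}"
proof
  have "c \<in> convex hull {p, q, r}" unfolding convex_hull_3 c using a less_imp_le by blast
  then show "convex hull {c, q, r} \<union> convex hull {c, r, p} \<union> convex hull {c, p, q} \<subseteq> convex hull {p, q, r}"
    by (intro Un_least hull_minimal convex_convex_hull) (auto intro: hull_inc)
  show "convex hull {p, q, r} \<subseteq> convex hull {c, q, r} \<union> convex hull {c, r, p} \<union> convex hull {c, p, q}"
  proof
    fix x assume "x \<in> convex hull {p, q, r}"
    then obtain u v w where uvw: "0 \<le> u" "0 \<le> v" "0 \<le> w" "u + v + w = 1"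
      and x: "x = u *\<^sub>R p + v *\<^sub>R q + w *\<^sub>R r"
      unfolding convex_hull_3 by blast
    have le: "y / b \<le> y' / b' \<longleftrightarrow> y * b' \<le> y' * b" if "0 < b" "0 < b'" for y b y' b' :: real
      using that by (simp add: field_simps)
    consider "w / a\<^sub>3 \<le> u / a\<^sub>1" "w / a\<^sub>3 \<le> v / a\<^sub>2" | "u / a\<^sub>1 \<le> v / a\<^sub>2" "u / a\<^sub>1 \<le> w / a\<^sub>3"
      | "v / a\<^sub>2 \<le> w / a\<^sub>3" "v / a\<^sub>2 \<le> u / a\<^sub>1" by linarith
    then show "x \<in> convex hull {c, q, r} \<union> convex hull {c, r, p} \<union> convex hull {c, p, q}"
    proof cases
      case 1
      then have "x \<in> convex hull {c, p, q}"
        unfolding x c using a uvw by (intro convex_hull_3_centre_aux) (auto simp: le)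
      then show ?thesis by simp
    next
      case 2
      have "v *\<^sub>R q + w *\<^sub>R r + u *\<^sub>R p \<in> convex hull {a\<^sub>2 *\<^sub>R q + a\<^sub>3 *\<^sub>R r + a\<^sub>1 *\<^sub>R p, q, r}"
        using 2 a uvw by (intro convex_hull_3_centre_aux) (auto simp: le)
      then show ?thesis by (simp add: x c add_ac)
    next
      case 3
      have "w *\<^sub>R r + u *\<^sub>R p + v *\<^sub>R q \<in> convex hull {a\<^sub>3 *\<^sub>R r + a\<^sub>1 *\<^sub>R p + a\<^sub>2 *\<^sub>R q, r, p}"
        using 3 a uvw by (intro convex_hull_3_centre_aux) (auto simp: le)
      then show ?thesis by (simp add: x c add_ac)
    qed
  qed
qed

section \<open>The Powell--Sabin split\<close>

text \<open>The counter-clockwise order of the boundary points is 1, 6, 2, 4, 3, 5, since the point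
  with index 3 + i lies on the edge opposite vertex i.\<close>

definition ps_next :: "nat \<Rightarrow> nat" where
  "ps_next k = (if k = 1 then 6 else if k = 6 then 2 else if k = 2 then 4
     else if k = 4 then 3 else if k = 3 then 5 else 1)"

lemma ps_next_simps:
  "ps_next 1 = 6" "ps_next 6 = 2" "ps_next 2 = 4" "ps_next 4 = 3" "ps_next 3 = 5" "ps_next 5 = 1"
  by (simp_all add: ps_next_def)

lemma nxt_simps: "nxt 1 = 2" "nxt 2 = 3" "nxt 3 = 1"
  by (simp_all add: nxt_def)

lemma atLeastAtMost_1_6: "{1..6} = {1, 2, 3, 4, 5, 6 :: nat}"
  by auto

lemma atLeastAtMost_1_3: "{1..3} = {1, 2, 3 :: nat}"
  by auto

lemma ps_bdry_edges_eq: "ps_bdry_edges z = (\<lambda>k. (z k, z (ps_next k))) ` {1..6}"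
proof -
  have "3 + 1 = (4::nat)" "3 + 2 = (5::nat)" "3 + 3 = (6::nat)" by simp_all
  then have "ps_bdry_edges z = {(z 2, z 4), (z 4, z 3)} \<union> {(z 3, z 5), (z 5, z 1)} \<union> {(z 1, z 6), (z 6, z 2)}"
    unfolding ps_bdry_edges_def atLeastAtMost_1_3
    by (simp only: UN_insert UN_empty nxt_simps Un_empty_right Un_assoc)
  also have "\<dots> = (\<lambda>k. (z k, z (ps_next k))) ` {1..6}"
    unfolding atLeastAtMost_1_6 image_insert image_empty ps_next_simps by blast
  finally show ?thesis .
qed

text \<open>Recovers the weight \<open>m\<close> of the split point: each ratio is \<open>m\<close>
  plus a nonnegative term, and the term of a vertex that does not occur is 0.\<close>

lemma min_centre:
  fixes m :: real
  assumes "0 < a\<^sub>1" "0 < a\<^sub>2" "0 < a\<^sub>3" "0 \<le> e\<^sub>1" "0 \<le> e\<^sub>2" "0 \<le> e\<^sub>3" "e\<^sub>1 = 0 \<or> e\<^sub>2 = 0 \<or> e\<^sub>3 = 0"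
  shows "min ((m * a\<^sub>1 + e\<^sub>1) / a\<^sub>1) (min ((m * a\<^sub>2 + e\<^sub>2) / a\<^sub>2) ((m * a\<^sub>3 + e\<^sub>3) / a\<^sub>3)) = m"
proof -
  have "(m * a + e) / a = m + e / a" if "0 < a" for a e :: real using that by (simp add: add_divide_distrib)
  moreover have "0 \<le> e\<^sub>1 / a\<^sub>1" "0 \<le> e\<^sub>2 / a\<^sub>2" "0 \<le> e\<^sub>3 / a\<^sub>3" using assms by simp_all
  moreover have "min (m + x) (min (m + y) (m + w)) = m"
    if "0 \<le> x" "0 \<le> y" "0 \<le> w" "x = 0 \<or> y = 0 \<or> w = 0" for x y w
    using that by (auto simp: min_def)
  ultimately show ?thesis using assms(1-3,7) by simp
qed

text \<open>The hat functions are given by formulas valid on the whole plane, so continuity is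
  immediate, and what remains is to evaluate them in the six triangles.\<close>

lemma ps_fan:
  assumes "ps_points z"
  obtains lam where "fan {1..6} ps_next 1 (z 0) z (ps_triangle z) lam"
proof -
  have or: "(z 2 - z 1) $ 1 * (z 3 - z 1) $ 2 - (z 2 - z 1) $ 2 * (z 3 - z 1) $ 1 > 0"
    and int: "z 0 \<in> interior (ps_triangle z)"
    and seg: "\<And>i. i \<in> {1..3} \<Longrightarrow> z (3 + i) \<in> open_segment (z (nxt i)) (z (nxt (nxt i)))"
    using assms by (auto simp: ps_points_def)
  have seg4: "z 4 \<in> open_segment (z 2) (z 3)" and seg5: "z 5 \<in> open_segment (z 3) (z 1)"
    and seg6: "z 6 \<in> open_segment (z 1) (z 2)"
    using seg[of 1] seg[of 2] seg[of 3] by (simp_all only: nxt_simps) simp_all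
  obtain a\<^sub>1 a\<^sub>2 a\<^sub>3 where a: "0 < a\<^sub>1" "0 < a\<^sub>2" "0 < a\<^sub>3" "a\<^sub>1 + a\<^sub>2 + a\<^sub>3 = 1"
    and z0: "z 0 = a\<^sub>1 *\<^sub>R z 1 + a\<^sub>2 *\<^sub>R z 2 + a\<^sub>3 *\<^sub>R z 3"
    using int interior_convex_hull_3_minimal[OF not_collinear_if_orientation_pos[OF or]]
    by (auto simp: ps_triangle_def)
  obtain u\<^sub>4 where u4: "0 < u\<^sub>4" "u\<^sub>4 < 1" and z4: "z 4 = (1 - u\<^sub>4) *\<^sub>R z 2 + u\<^sub>4 *\<^sub>R z 3"
    using seg4 by (auto simp: in_segment)
  obtain u\<^sub>5 where u5: "0 < u\<^sub>5" "u\<^sub>5 < 1" and z5: "z 5 = (1 - u\<^sub>5) *\<^sub>R z 3 + u\<^sub>5 *\<^sub>R z 1"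
    using seg5 by (auto simp: in_segment)
  obtain u\<^sub>6 where u6: "0 < u\<^sub>6" "u\<^sub>6 < 1" and z6: "z 6 = (1 - u\<^sub>6) *\<^sub>R z 1 + u\<^sub>6 *\<^sub>R z 2"
    using seg6 by (auto simp: in_segment)
  obtain b\<^sub>1 b\<^sub>2 b\<^sub>3 where contb: "continuous_on UNIV b\<^sub>1" "continuous_on UNIV b\<^sub>2" "continuous_on UNIV b\<^sub>3"
    and b: "\<And>c\<^sub>1 c\<^sub>2 c\<^sub>3. c\<^sub>1 + c\<^sub>2 + c\<^sub>3 = 1 \<Longrightarrow> b\<^sub>1 (c\<^sub>1 *\<^sub>R z 1 + c\<^sub>2 *\<^sub>R z 2 + c\<^sub>3 *\<^sub>R z 3) = c\<^sub>1"
      "\<And>c\<^sub>1 c\<^sub>2 c\<^sub>3. c\<^sub>1 + c\<^sub>2 + c\<^sub>3 = 1 \<Longrightarrow> b\<^sub>2 (c\<^sub>1 *\<^sub>R z 1 + c\<^sub>2 *\<^sub>R z 2 + c\<^sub>3 *\<^sub>R z 3) = c\<^sub>2"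
      "\<And>c\<^sub>1 c\<^sub>2 c\<^sub>3. c\<^sub>1 + c\<^sub>2 + c\<^sub>3 = 1 \<Longrightarrow> b\<^sub>3 (c\<^sub>1 *\<^sub>R z 1 + c\<^sub>2 *\<^sub>R z 2 + c\<^sub>3 *\<^sub>R z 3) = c\<^sub>3"
    using barycentric_coordinates[OF or] by blast
  \<comment> \<open>\<open>M\<close> is the coefficient of \<open>z 0\<close> and the \<open>\<mu>\<close> are the coefficients of the vertices in the
    split of the triangle into three; \<open>\<kappa>\<close> is the share of the point on an edge, and
    subtracting it from its two neighbours gives the coordinates for the six-fold split.\<close>
  define M where "M x = min (b\<^sub>1 x / a\<^sub>1) (min (b\<^sub>2 x / a\<^sub>2) (b\<^sub>3 x / a\<^sub>3))" for x
  define \<mu>\<^sub>1 where "\<mu>\<^sub>1 x = b\<^sub>1 x - a\<^sub>1 * M x" for x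
  define \<mu>\<^sub>2 where "\<mu>\<^sub>2 x = b\<^sub>2 x - a\<^sub>2 * M x" for x
  define \<mu>\<^sub>3 where "\<mu>\<^sub>3 x = b\<^sub>3 x - a\<^sub>3 * M x" for x
  define \<kappa>\<^sub>4 where "\<kappa>\<^sub>4 x = min (\<mu>\<^sub>2 x / (1 - u\<^sub>4)) (\<mu>\<^sub>3 x / u\<^sub>4)" for x
  define \<kappa>\<^sub>5 where "\<kappa>\<^sub>5 x = min (\<mu>\<^sub>3 x / (1 - u\<^sub>5)) (\<mu>\<^sub>1 x / u\<^sub>5)" for x
  define \<kappa>\<^sub>6 where "\<kappa>\<^sub>6 x = min (\<mu>\<^sub>1 x / (1 - u\<^sub>6)) (\<mu>\<^sub>2 x / u\<^sub>6)" for x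
  define lam :: "nat \<Rightarrow> real^2 \<Rightarrow> real" where
    "lam k x = (if k = 1 then \<mu>\<^sub>1 x - u\<^sub>5 * \<kappa>\<^sub>5 x - (1 - u\<^sub>6) * \<kappa>\<^sub>6 x
      else if k = 2 then \<mu>\<^sub>2 x - u\<^sub>6 * \<kappa>\<^sub>6 x - (1 - u\<^sub>4) * \<kappa>\<^sub>4 x
      else if k = 3 then \<mu>\<^sub>3 x - u\<^sub>4 * \<kappa>\<^sub>4 x - (1 - u\<^sub>5) * \<kappa>\<^sub>5 x
      else if k = 4 then \<kappa>\<^sub>4 x else if k = 5 then \<kappa>\<^sub>5 x else \<kappa>\<^sub>6 x)" for k x
  have "continuous_on UNIV M" unfolding M_def using a by (auto intro!: continuous_intros contb)
  then have cont\<mu>: "continuous_on UNIV \<mu>\<^sub>1" "continuous_on UNIV \<mu>\<^sub>2" "continuous_on UNIV \<mu>\<^sub>3"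
    unfolding \<mu>\<^sub>1_def \<mu>\<^sub>2_def \<mu>\<^sub>3_def by (auto intro!: continuous_intros contb)
  then have cont\<kappa>: "continuous_on UNIV \<kappa>\<^sub>4" "continuous_on UNIV \<kappa>\<^sub>5" "continuous_on UNIV \<kappa>\<^sub>6"
    unfolding \<kappa>\<^sub>4_def \<kappa>\<^sub>5_def \<kappa>\<^sub>6_def using u4 u5 u6 by (auto intro!: continuous_intros)
  have cont: "continuous_on UNIV (lam k)" for k
    unfolding lam_def using cont\<mu> cont\<kappa>
    by (cases "k = 1"; cases "k = 2"; cases "k = 3"; cases "k = 4"; cases "k = 5")
      (auto intro!: continuous_intros)
  have \<mu>: "\<mu>\<^sub>1 x = e\<^sub>1 \<and> \<mu>\<^sub>2 x = e\<^sub>2 \<and> \<mu>\<^sub>3 x = e\<^sub>3"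
    if x: "x = z 0 + (e\<^sub>1 *\<^sub>R (z 1 - z 0) + e\<^sub>2 *\<^sub>R (z 2 - z 0) + e\<^sub>3 *\<^sub>R (z 3 - z 0))"
      and e: "0 \<le> e\<^sub>1" "0 \<le> e\<^sub>2" "0 \<le> e\<^sub>3" "e\<^sub>1 = 0 \<or> e\<^sub>2 = 0 \<or> e\<^sub>3 = 0"
    for x e\<^sub>1 e\<^sub>2 e\<^sub>3
  proof -
    define m where "m = 1 - e\<^sub>1 - e\<^sub>2 - e\<^sub>3"
    have "x = m *\<^sub>R z 0 + e\<^sub>1 *\<^sub>R z 1 + e\<^sub>2 *\<^sub>R z 2 + e\<^sub>3 *\<^sub>R z 3"
      unfolding x m_def by (simp add: algebra_simps)
    then have x': "x = (m * a\<^sub>1 + e\<^sub>1) *\<^sub>R z 1 + (m * a\<^sub>2 + e\<^sub>2) *\<^sub>R z 2 + (m * a\<^sub>3 + e\<^sub>3) *\<^sub>R z 3"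
      by (simp add: z0 algebra_simps)
    have "(m * a\<^sub>1 + e\<^sub>1) + (m * a\<^sub>2 + e\<^sub>2) + (m * a\<^sub>3 + e\<^sub>3) = m * (a\<^sub>1 + a\<^sub>2 + a\<^sub>3) + e\<^sub>1 + e\<^sub>2 + e\<^sub>3"
      by (simp add: algebra_simps)
    also have "\<dots> = 1" using a by (simp add: m_def)
    finally have sum: "(m * a\<^sub>1 + e\<^sub>1) + (m * a\<^sub>2 + e\<^sub>2) + (m * a\<^sub>3 + e\<^sub>3) = 1" .
    have bx: "b\<^sub>1 x = m * a\<^sub>1 + e\<^sub>1" "b\<^sub>2 x = m * a\<^sub>2 + e\<^sub>2" "b\<^sub>3 x = m * a\<^sub>3 + e\<^sub>3"
      unfolding x' by (rule b[OF sum])+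
    have "M x = m" unfolding M_def bx using a e by (intro min_centre)
    then show ?thesis by (simp add: \<mu>\<^sub>1_def \<mu>\<^sub>2_def \<mu>\<^sub>3_def bx)
  qed
  \<comment> \<open>\<open>min0\<close> evaluates \<kappa> for the edges that the triangle does not
    touch along a side, where one neighbouring \<mu> is 0; \<open>min1\<close> evaluates it for the
    edge carrying the outer side.\<close>
  have min0: "min (e / p) 0 = 0" "min 0 (e / p) = 0" if "0 \<le> e" "0 < p" for e p :: real
    using that by (simp_all add: min_absorb1 min_absorb2 divide_nonneg_pos)
  have min1: "min ((s + p * t) / p) t = t" "min t ((s + p * t) / p) = t"
    if "0 \<le> s" "0 < p" for s t p :: real
    using that by (simp_all add: add_divide_distrib min_absorb1 min_absorb2 divide_nonneg_pos)
  have eval: "lam k (z 0 + s *\<^sub>R (z l - z 0) + t *\<^sub>R (z (ps_next l) - z 0))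
      = (if k = l then s else if k = ps_next l then t else 0)"
    if k: "k \<in> {1..6}" and l: "l \<in> {1..6}" and st: "0 \<le> s" "0 \<le> t" for k l s t
  proof -
    define x where "x = z 0 + s *\<^sub>R (z l - z 0) + t *\<^sub>R (z (ps_next l) - z 0)"
    have k': "k = 1 \<or> k = 2 \<or> k = 3 \<or> k = 4 \<or> k = 5 \<or> k = 6" using k by auto
    consider "l = 1" | "l = 2" | "l = 3" | "l = 4" | "l = 5" | "l = 6" using l by fastforce
    then have "lam k x = (if k = l then s else if k = ps_next l then t else 0)"
    proof cases
      case 1
      \<comment> \<open>Obtained by expressing \<open>z 6\<close> through \<open>z 1\<close> and
        \<open>z 2\<close>. The other five cases differ in the edge and in which of its halves is
        the outer side.\<close>
      have "\<mu>\<^sub>1 x = s + (1 - u\<^sub>6) * t \<and> \<mu>\<^sub>2 x = u\<^sub>6 * t \<and> \<mu>\<^sub>3 x = 0"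
        by (rule \<mu>, simp add: x_def 1 ps_next_def z6 algebra_simps) (use st u6 in simp_all)
      then show ?thesis using k' st u4 u5 u6
        by (auto simp: lam_def \<kappa>\<^sub>4_def \<kappa>\<^sub>5_def \<kappa>\<^sub>6_def 1 ps_next_def min0 min1)
    next
      case 2
      have "\<mu>\<^sub>1 x = 0 \<and> \<mu>\<^sub>2 x = s + (1 - u\<^sub>4) * t \<and> \<mu>\<^sub>3 x = u\<^sub>4 * t"
        by (rule \<mu>, simp add: x_def 2 ps_next_def z4 algebra_simps) (use st u4 in simp_all)
      then show ?thesis using k' st u4 u5 u6
        by (auto simp: lam_def \<kappa>\<^sub>4_def \<kappa>\<^sub>5_def \<kappa>\<^sub>6_def 2 ps_next_def min0 min1)
    next
      case 3
      have "\<mu>\<^sub>1 x = u\<^sub>5 * t \<and> \<mu>\<^sub>2 x = 0 \<and> \<mu>\<^sub>3 x = s + (1 - u\<^sub>5) * t"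
        by (rule \<mu>, simp add: x_def 3 ps_next_def z5 algebra_simps) (use st u5 in simp_all)
      then show ?thesis using k' st u4 u5 u6
        by (auto simp: lam_def \<kappa>\<^sub>4_def \<kappa>\<^sub>5_def \<kappa>\<^sub>6_def 3 ps_next_def min0 min1)
    next
      case 4
      have "\<mu>\<^sub>1 x = 0 \<and> \<mu>\<^sub>2 x = (1 - u\<^sub>4) * s \<and> \<mu>\<^sub>3 x = t + u\<^sub>4 * s"
        by (rule \<mu>, simp add: x_def 4 ps_next_def z4 algebra_simps) (use st u4 in simp_all)
      then show ?thesis using k' st u4 u5 u6
        by (auto simp: lam_def \<kappa>\<^sub>4_def \<kappa>\<^sub>5_def \<kappa>\<^sub>6_def 4 ps_next_def min0 min1)
    next
      case 5
      have "\<mu>\<^sub>1 x = t + u\<^sub>5 * s \<and> \<mu>\<^sub>2 x = 0 \<and> \<mu>\<^sub>3 x = (1 - u\<^sub>5) * s"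
        by (rule \<mu>, simp add: x_def 5 ps_next_def z5 algebra_simps) (use st u5 in simp_all)
      then show ?thesis using k' st u4 u5 u6
        by (auto simp: lam_def \<kappa>\<^sub>4_def \<kappa>\<^sub>5_def \<kappa>\<^sub>6_def 5 ps_next_def min0 min1)
    next
      case 6
      have "\<mu>\<^sub>1 x = (1 - u\<^sub>6) * s \<and> \<mu>\<^sub>2 x = t + u\<^sub>6 * s \<and> \<mu>\<^sub>3 x = 0"
        by (rule \<mu>, simp add: x_def 6 ps_next_def z6 algebra_simps) (use st u6 in simp_all)
      then show ?thesis using k' st u4 u5 u6
        by (auto simp: lam_def \<kappa>\<^sub>4_def \<kappa>\<^sub>5_def \<kappa>\<^sub>6_def 6 ps_next_def min0 min1)
    qed
    then show ?thesis unfolding x_def .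
  qed
  have "fan {1..6} ps_next 1 (z 0) z (ps_triangle z) lam"
  proof
    \<comment> \<open>The split into three triangles at \<open>z 0\<close>, followed by halving each
      one at its edge point.\<close>
    show "ps_triangle z = (\<Union>k\<in>{1..6}. convex hull {z 0, z k, z (ps_next k)})"
      unfolding ps_triangle_def convex_hull_3_centre[OF a z0] convex_hull_split_edge[OF seg4, of "z 0"]
        convex_hull_split_edge[OF seg5, of "z 0"] convex_hull_split_edge[OF seg6, of "z 0"] atLeastAtMost_1_6
        UN_insert UN_empty ps_next_simps by blast
    have "frontier (ps_triangle z) = closed_segment (z 1) (z 2) \<union> closed_segment (z 2) (z 3) \<union> closed_segment (z 3) (z 1)"
      unfolding ps_triangle_def by (rule frontier_of_triangle) simp
    also have "\<dots> = (closed_segment (z 1) (z 6) \<union> closed_segment (z 6) (z 2))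
        \<union> (closed_segment (z 2) (z 4) \<union> closed_segment (z 4) (z 3))
        \<union> (closed_segment (z 3) (z 5) \<union> closed_segment (z 5) (z 1))"
      using Un_closed_segment[OF open_closed_segment[OF seg4]]
        Un_closed_segment[OF open_closed_segment[OF seg5]]
        Un_closed_segment[OF open_closed_segment[OF seg6]] by simp
    also have "\<dots> = (\<Union>k\<in>{1..6}. closed_segment (z k) (z (ps_next k)))"
      unfolding atLeastAtMost_1_6 UN_insert UN_empty ps_next_simps by blast
    finally show "frontier (ps_triangle z) = \<dots>" .
    show "convex (ps_triangle z)" by (simp add: ps_triangle_def)
    show "continuous_on (ps_triangle z) (lam k)" for k
      using cont continuous_on_subset by blast
  qed (use int eval in \<open>auto simp: ps_next_def\<close>)
  then show ?thesis by (rule that)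
qed

theorem lemma4p8:
  fixes z :: "nat \<Rightarrow> real^2" and r :: nat
  assumes "ps_points z" and "r \<ge> 1"
  shows
    "fun_space.dim (lagrange r z) = 3 * r\<^sup>2 + 3 * r + 1 \<and>
     card (z ` {1..3}) = 3 \<and>
     card (z ` {4..6}) = 3 \<and>
     (\<Sum>(a, b) \<in> ps_bdry_edges z.
        fun_space.dim (polys_on (int r - 2) (closed_segment a b))) = 6 * (r - 1) \<and>
     fun_space.dim (lagrange0 r z) = 3 * r * (r - 1) \<and>
     card (z ` {1..3}) + card (z ` {4..6})
       + (\<Sum>(a, b) \<in> ps_bdry_edges z.
            fun_space.dim (polys_on (int r - 2) (closed_segment a b)))
       + 1 + fun_space.dim (lagrange0 r z) = fun_space.dim (lagrange r z) \<and>
     (\<forall>q \<in> lagrange r z.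
        (\<forall>i \<in> {1..3}. q (z i) = 0) \<and>
        (\<forall>i \<in> {1..3}. q (z (3 + i)) = 0) \<and>
        (\<forall>(a, b) \<in> ps_bdry_edges z. \<forall>p \<in> polys_on (int r - 2) (closed_segment a b).
           edge_integral a b (\<lambda>x. q x * p x) = 0) \<and>
        integral (ps_triangle z) q = 0 \<and>
        (\<forall>p \<in> lagrange0 r z. integral (ps_triangle z) (\<lambda>x. q x * p x) = 0)
        \<longrightarrow> q = 0)"
proof -
  obtain lam where "fan {1..6} ps_next 1 (z 0) z (ps_triangle z) lam"
    using ps_fan[OF assms(1)] .
  then interpret fan "{1..6}" ps_next 1 "z 0" z "ps_triangle z" lam .
  have lagrange: "lagrange r z = fan_space r"
    unfolding lagrange_def fan_space_def ps_split_def ps_bdry_edges_eq tri_def by simp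
  have lagrange0: "lagrange0 r z = fan_space0 r"
    unfolding lagrange0_def fan_space0_def lagrange ..
  \<comment> \<open>The hat function \<open>lam k\<close> is 1 at \<open>z k\<close> and 0 at the
    other five points. Distinctness of the points is what makes the counts of point values and of
    boundary edges correct.\<close>
  have inj: "inj_on z {1..6}"
  proof (rule inj_onI)
    fix k l :: nat assume kl: "k \<in> {1..6}" "l \<in> {1..6}" "z k = z l"
    have "lam k (z k) = 1" "lam k (z l) = (if k = l then 1 else 0)"
      using lam_eval[OF kl(1) kl(1), of 1 0] lam_eval[OF kl(1) kl(2), of 1 0] by simp_all
    then show "k = l" using kl(3) by (simp split: if_splits)
  qed
  have next_neq: "z k \<noteq> z (ps_next k)" if "k \<in> {1..6}" for k
    using inj_onD[OF inj _ that nx(1)[OF that]] nx(2)[OF that] by metis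
  have card: "card (z ` {1..3}) = 3" "card (z ` {4..6}) = 3"
    using inj_on_subset[OF inj, of "{1..3}"] inj_on_subset[OF inj, of "{4..6}"]
    by (simp_all add: card_image)
  have edges: "(\<Sum>(a, b) \<in> ps_bdry_edges z.
        fun_space.dim (polys_on (int r - 2) (closed_segment a b))) = 6 * (r - 1)"
  proof -
    have "inj_on (\<lambda>k. (z k, z (ps_next k))) {1..6}"
      using inj by (simp add: inj_on_def)
    then show ?thesis
      unfolding ps_bdry_edges_eq
      by (simp add: sum.reindex dim_polys_on_segment[OF next_neq])
  qed
  have dim: "fun_space.dim (lagrange r z) = 3 * r\<^sup>2 + 3 * r + 1"
  proof -
    have "2 * fun_space.dim (lagrange r z) = card {1..6::nat} * (r * (r + 1)) + 2"
      unfolding lagrange dim_fan_space_idx by (rule card_idx)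
    then show ?thesis by (simp add: power2_eq_square)
  qed
  have dim0: "fun_space.dim (lagrange0 r z) = 3 * r * (r - 1)"
  proof -
    have "2 * fun_space.dim (lagrange0 r z) = card {1..6::nat} * ((r - 1) * r)"
      unfolding lagrange0 dim_fan_space0_idx0[OF assms(2)] by (rule card_idx0)
    then show ?thesis by simp
  qed
  \<comment> \<open>Writing \<open>r\<close> as a successor removes the truncated subtraction from
    the count.\<close>
  obtain n where n: "r = Suc n" using assms(2) by (cases r) auto
  have total: "3 + 3 + 6 * (r - 1) + 1 + 3 * r * (r - 1) = 3 * r\<^sup>2 + 3 * r + 1"
    by (simp add: n power2_eq_square algebra_simps)
  have "q = 0" if q: "q \<in> lagrange r z"
    and vertices: "\<forall>i \<in> {1..3}. q (z i) = 0" "\<forall>i \<in> {1..3}. q (z (3 + i)) = 0"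
    and moments: "\<forall>(a, b) \<in> ps_bdry_edges z. \<forall>p \<in> polys_on (int r - 2) (closed_segment a b).
           edge_integral a b (\<lambda>x. q x * p x) = 0"
    and mean: "integral (ps_triangle z) q = 0"
    and orth: "\<forall>p \<in> lagrange0 r z. integral (ps_triangle z) (\<lambda>x. q x * p x) = 0" for q
  proof
    fix x
    have "q x = 0"
    proof (rule fan_space_unisolvent[OF _ assms(2) _ _ mean])
      show "q (z k) = 0" if "k \<in> {1..6}" for k
      proof (cases "k \<le> 3")
        case True
        with that vertices(1) show ?thesis by simp
      next
        case False
        then have "3 + (k - 3) = k" "k - 3 \<in> {1..3}" using that by auto
        with vertices(2) show ?thesis by metis
      qed
    qed (use q moments orth in \<open>auto simp: lagrange lagrange0 ps_bdry_edges_eq\<close>)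
    then show "q x = 0 x" by simp
  qed
  then show ?thesis using card edges dim dim0 total by simp
qed

end
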